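(* Let $G$ be a finite simple graph that contains no induced subgraph isomorphic to the co-gem (the graph consisting of an induced path $v_1v_2v_3v_4$ on four vertices together with a fifth vertex $x$ adjacent to none of $v_1,\dots,v_4$), and let $t\colon V(G)\to C$ be a template. Then an optimal paint plan that paints $t$ onto $G$ can be computed in time polynomial in $|V(G)|$ and $|C|$.
   Context: Graphs are finite, undirected, without loops or multiple edges. A vertex set $A\subseteq V(G)$ is connected if the induced subgraph $G[A]$ is connected. A painting of $G$ is a (possibly partial) function $p\colon V(G)\to C$; a template is a total painting $t\colon V(G)\to C$. A brush stroke is a pair $(A,c)$ with $A\subseteq V(G)$ connected and $c\in C$; applying it to a painting $p$ yields the painting $p'$ with $p'(v)=c$ for $v\in A$ and $p'(v)=p(v)$ for $v\notin A$. A paint plan that paints $t$ onto $G$ in $s$ strokes is a non-empty sequence $(A_1,c_1),\dots,(A_s,c_s)$ of strokes such that, starting from the everywhere-undefined painting $p_0$ and letting $p_i$ be the result of applying $(A_i,c_i)$ to $p_{i-1}$, the final painting $p_s$ equals $t$. A paint plan is optimal if it has the minimum number of strokes among all paint plans that paint $t$ onto $G$. *)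

theory Defs
  imports "Graph_Theory.Graph_Theory" "HOL-Library.FuncSet"
begin

section \<open>Graphs\<close>

text \<open>
  A finite simple undirected graph is a \<^locale>\<open>pair_graph\<close>: finite, loopless, without parallel
  arcs, and with a symmetric arc set (an edge \<open>uv\<close> is the pair of arcs \<open>(u, v)\<close> and \<open>(v, u)\<close>).
\<close>

text \<open>The path \<open>0 - 1 - 2 - 3\<close> together with the isolated vertex \<open>4\<close>.\<close>

definition co_gem :: "nat pair_pre_digraph" where
  "co_gem = \<lparr> pverts = {0, 1, 2, 3, 4},
              parcs = {(0, 1), (1, 0), (1, 2), (2, 1), (2, 3), (3, 2)} \<rparr>"

definition co_gem_free :: "'v pair_pre_digraph \<Rightarrow> bool" where
  "co_gem_free G \<longleftrightarrow>
     \<not> (\<exists>A \<subseteq> pverts G. digraph_iso (induce_subgraph (with_proj G) A) (with_proj co_gem))"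

text \<open>The empty set is not connected, since \<^const>\<open>Digraph_Component.connected\<close> asks for a vertex.\<close>

definition connected_set :: "'v pair_pre_digraph \<Rightarrow> 'v set \<Rightarrow> bool" where
  "connected_set G A \<longleftrightarrow>
     A \<subseteq> pverts G \<and> Digraph_Component.connected (induce_subgraph (with_proj G) A)"


section \<open>Paint plans\<close>

type_synonym ('v, 'c) painting = "'v \<Rightarrow> 'c option"
type_synonym ('v, 'c) stroke = "'v set \<times> 'c"

fun apply_stroke :: "('v, 'c) stroke \<Rightarrow> ('v, 'c) painting \<Rightarrow> ('v, 'c) painting" where
  "apply_stroke (A, c) p = (\<lambda>v. if v \<in> A then Some c else p v)"

text \<open>Strokes are applied from left to right, starting with the everywhere undefined painting.\<close>

definition apply_plan :: "('v, 'c) stroke list \<Rightarrow> ('v, 'c) painting" where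
  "apply_plan ss = fold apply_stroke ss (\<lambda>_. None)"

definition is_stroke :: "'v pair_pre_digraph \<Rightarrow> 'c set \<Rightarrow> ('v, 'c) stroke \<Rightarrow> bool" where
  "is_stroke G C s \<longleftrightarrow> connected_set G (fst s) \<and> snd s \<in> C"

text \<open>A template is given by \<open>t \<in> pverts G \<rightarrow> C\<close>; its values outside \<open>pverts G\<close> are irrelevant.\<close>

definition paint_plan ::
    "'v pair_pre_digraph \<Rightarrow> 'c set \<Rightarrow> ('v \<Rightarrow> 'c) \<Rightarrow> ('v, 'c) stroke list \<Rightarrow> bool" where
  "paint_plan G C t ss \<longleftrightarrow>
     ss \<noteq> [] \<and> (\<forall>s \<in> set ss. is_stroke G C s) \<and>
     apply_plan ss = (\<lambda>v. if v \<in> pverts G then Some (t v) else None)"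

definition optimal_paint_plan ::
    "'v pair_pre_digraph \<Rightarrow> 'c set \<Rightarrow> ('v \<Rightarrow> 'c) \<Rightarrow> ('v, 'c) stroke list \<Rightarrow> bool" where
  "optimal_paint_plan G C t ss \<longleftrightarrow>
     paint_plan G C t ss \<and> (\<forall>ss'. paint_plan G C t ss' \<longrightarrow> length ss \<le> length ss')"


section \<open>Model of computation\<close>

text \<open>
  A first-order functional language over unlabelled binary trees. Variables are de Bruijn
  indices into an environment. \<open>ECase e e\<^sub>1 e\<^sub>2\<close> branches on whether \<open>e\<close> is a leaf, and
  binds the left and the right subtree as variables \<open>0\<close> and \<open>1\<close> in \<open>e\<^sub>2\<close>. \<open>ELet e b\<close> binds
  the value of \<open>e\<close> as variable \<open>0\<close> in \<open>b\<close>. A program is a list of function bodies, which may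
  be mutually recursive; function \<open>0\<close> is the main function. The body of a called function sees
  exactly the arguments of the call.
\<close>

datatype btree = Leaf | Node btree btree

datatype expr =
    EVar nat
  | ELeaf
  | ENode expr expr
  | ECase expr expr expr
  | ELet expr expr
  | ECall nat "expr list"

type_synonym program = "expr list"

text \<open>
  \<open>eval P env e v s\<close>: in the environment \<open>env\<close>, the expression \<open>e\<close> evaluates to \<open>v\<close> in \<open>s\<close> steps.
  Each evaluated subexpression costs one step. When trees are represented by pointers to immutable
  cells, one step is a number of elementary operations that depends on \<open>P\<close> only: a variable lookup
  copies a pointer, and a node allocates one cell. There is no operation that compares or copies
  whole trees at unit cost, and there is no built-in arithmetic. Hence polynomially many steps
  amount to polynomial time on a random access machine or a Turing machine.
\<close>

inductive
  eval :: "program \<Rightarrow> btree list \<Rightarrow> expr \<Rightarrow> btree \<Rightarrow> nat \<Rightarrow> bool" and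
  evals :: "program \<Rightarrow> btree list \<Rightarrow> expr list \<Rightarrow> btree list \<Rightarrow> nat \<Rightarrow> bool"
  for P :: program
where
  eval_Var: "i < length env \<Longrightarrow> eval P env (EVar i) (env ! i) 1"
| eval_Leaf: "eval P env ELeaf Leaf 1"
| eval_Node: "eval P env e1 v1 s1 \<Longrightarrow> eval P env e2 v2 s2 \<Longrightarrow>
    eval P env (ENode e1 e2) (Node v1 v2) (1 + s1 + s2)"
| eval_Case_Leaf: "eval P env e Leaf s \<Longrightarrow> eval P env e1 v s1 \<Longrightarrow>
    eval P env (ECase e e1 e2) v (1 + s + s1)"
| eval_Case_Node: "eval P env e (Node x y) s \<Longrightarrow> eval P (x # y # env) e2 v s2 \<Longrightarrow>
    eval P env (ECase e e1 e2) v (1 + s + s2)"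
| eval_Let: "eval P env e x s \<Longrightarrow> eval P (x # env) b v s' \<Longrightarrow>
    eval P env (ELet e b) v (1 + s + s')"
| eval_Call: "f < length P \<Longrightarrow> evals P env es vs s \<Longrightarrow> eval P vs (P ! f) v s' \<Longrightarrow>
    eval P env (ECall f es) v (1 + s + s')"
| evals_Nil: "evals P env [] [] 0"
| evals_Cons: "eval P env e v s \<Longrightarrow> evals P env es vs s' \<Longrightarrow>
    evals P env (e # es) (v # vs) (s + s')"

inductive_cases eval_VarE: "eval P env (EVar i) v s"
inductive_cases eval_LeafE: "eval P env ELeaf v s"
inductive_cases eval_NodeE: "eval P env (ENode e1 e2) v s"
inductive_cases eval_CaseE: "eval P env (ECase e e1 e2) v s"
inductive_cases eval_LetE: "eval P env (ELet e b) v s"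
inductive_cases eval_CallE: "eval P env (ECall f es) v s"
inductive_cases evals_NilE: "evals P env [] vs s"
inductive_cases evals_ConsE: "evals P env (e # es) vs s"

lemma
  shows eval_deterministic:
    "eval P env e v s \<Longrightarrow> eval P env e v' s' \<Longrightarrow> v' = v \<and> s' = s"
  and evals_deterministic:
    "evals P env es vs s \<Longrightarrow> evals P env es vs' s' \<Longrightarrow> vs' = vs \<and> s' = s"
proof (induction arbitrary: v' s' and vs' s' rule: eval_evals.inducts)
  case (eval_Node env e1 v1 s1 e2 v2 s2)
  from eval_Node.prems show ?case
    by (rule eval_NodeE) (auto dest: eval_Node.IH(2,4))
next
  case (eval_Case_Leaf env e s e1 v s1 e2)
  from eval_Case_Leaf.prems show ?case
    by (rule eval_CaseE) (auto dest: eval_Case_Leaf.IH(2,4))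
next
  case (eval_Case_Node env e x y s e2 v s2 e1)
  from eval_Case_Node.prems show ?case
    by (rule eval_CaseE) (auto dest: eval_Case_Node.IH(2,4))
next
  case (eval_Let env e x s b v s')
  from eval_Let.prems show ?case
    by (rule eval_LetE) (auto dest: eval_Let.IH(2,4))
next
  case (eval_Call f env es vs s v s')
  from eval_Call.prems show ?case
    by (rule eval_CallE) (auto dest: eval_Call.IH(3,5))
next
  case (evals_Cons env e v s es vs s')
  from evals_Cons.prems show ?case
    by (rule evals_ConsE) (auto dest: evals_Cons.IH(2,4))
qed (auto elim: eval_VarE eval_LeafE evals_NilE)

definition computes :: "program \<Rightarrow> btree list \<Rightarrow> btree \<Rightarrow> nat \<Rightarrow> bool" where
  "computes P inputs v s \<longleftrightarrow> P \<noteq> [] \<and> eval P inputs (P ! 0) v s"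


section \<open>Encoding of instances and of paint plans\<close>

text \<open>
  Vertices and colours are numbers below \<open>n\<close> and \<open>k\<close>. They are written in unary, which leaves the
  size of an instance polynomial in \<open>n\<close> and \<open>k\<close>. A graph is given by its adjacency matrix.
\<close>

definition enc_list :: "btree list \<Rightarrow> btree" where
  "enc_list xs = foldr Node xs Leaf"

definition enc_nat :: "nat \<Rightarrow> btree" where
  "enc_nat m = enc_list (replicate m Leaf)"

definition enc_bool :: "bool \<Rightarrow> btree" where
  "enc_bool b = (if b then Node Leaf Leaf else Leaf)"

definition enc_graph :: "nat \<Rightarrow> nat pair_pre_digraph \<Rightarrow> btree" where
  "enc_graph n G =
     enc_list (map (\<lambda>u. enc_list (map (\<lambda>v. enc_bool ((u, v) \<in> parcs G)) [0..<n])) [0..<n])"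

definition enc_template :: "nat \<Rightarrow> (nat \<Rightarrow> nat) \<Rightarrow> btree" where
  "enc_template n t = enc_list (map (\<lambda>v. enc_nat (t v)) [0..<n])"

definition enc_stroke :: "(nat, nat) stroke \<Rightarrow> btree" where
  "enc_stroke s = Node (enc_list (map enc_nat (sorted_list_of_set (fst s)))) (enc_nat (snd s))"

definition enc_plan :: "(nat, nat) stroke list \<Rightarrow> btree" where
  "enc_plan ss = enc_list (map enc_stroke ss)"

end

theory Submission
  imports Defs
begin

text \<open>
  Read a paint plan backwards: the last stroke is monochromatic in \<open>t\<close>, and once it is removed its
  vertices may be regarded as wildcards, which the strokes before it may cover freely. If some
  colour can be finished by a single stroke, doing so is optimal, because every plan spends a
  stroke on that colour anyway. So only the strokes that do not finish a colour require branching,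
  and their number is the excess over the trivial lower bound, the number of colours.

  In a connected co-gem-free graph at most four such strokes are needed: an induced \<open>P\<^sub>4\<close> dominates
  the graph, and a connected \<open>P\<^sub>4\<close>-free graph with at least two vertices has a dominating edge.
  As soon as a connected dominating set consists of wildcards, every colour takes one stroke.
  Iterative deepening over the number of non-finishing strokes, applied to each component with all
  other vertices as wildcards, is therefore a polynomial algorithm.
\<close>

section \<open>Paint plans read backwards\<close>

text \<open>Enlarging the wildcard set never invalidates a completion
  (\<open>completes_mono\<close>). Hence a backward stroke may be taken as large as possible: the
  component of a vertex in the wildcards together with its colour class. Branching then ranges over
  vertices instead of connected sets, so the search tree has depth at most four and degree at most
  the number of vertices.

  The depth is the excess over \<open>ncols\<close> because a finishing stroke lowers
  \<open>ncols\<close> by exactly one and any other maximal stroke leaves it unchanged. The four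
  comes from the vertices of an induced path, which may all differ in colour and become wildcards
  one at a time.

  Only the excess of a single component is bounded: an edgeless graph in one colour already needs as
  many strokes as vertices. The search therefore runs per component, and the minimum lengths add up
  because a connected stroke meets only one component.

  For the time bound the algorithm is written out in the tree language, and each function is given
  its exact value together with a bound on its steps.\<close>

fun first_some :: "('a \<Rightarrow> 'b option) \<Rightarrow> 'a list \<Rightarrow> 'b option" where
  "first_some f [] = None"
| "first_some f (x # xs) = (case f x of None \<Rightarrow> first_some f xs | Some y \<Rightarrow> Some y)"

lemma first_some_None_iff: "first_some f xs = None \<longleftrightarrow> (\<forall>x \<in> set xs. f x = None)"
  by (induction xs) (auto split: option.splits)

lemma first_some_SomeD: "first_some f xs = Some y \<Longrightarrow> \<exists>x \<in> set xs. f x = Some y"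
  by (induction xs) (auto split: option.splits)

text \<open>For iterative deepening a successful depth alone is not enough: the failure of all
  smaller depths later yields the lower bound on the number of strokes.\<close>

lemma first_some_upt_SomeD:
  assumes "first_some f [i..<j] = Some y"
  obtains m where "i \<le> m" "f m = Some y" "\<forall>l. i \<le> l \<longrightarrow> l < m \<longrightarrow> f l = None"
proof -
  have "\<exists>m\<ge>i. f m = Some y \<and> (\<forall>l. i \<le> l \<longrightarrow> l < m \<longrightarrow> f l = None)"
    using assms
  proof (induction "j - i" arbitrary: i)
    case 0
    then show ?case by simp
  next
    case (Suc k)
    then have e: "[i..<j] = i # [Suc i..<j]" by (simp add: upt_conv_Cons)
    show ?case
    proof (cases "f i")
      case None
      with Suc.prems e have "first_some f [Suc i..<j] = Some y" by simp
      moreover have "k = j - Suc i" using Suc.hyps(2) by simp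
      ultimately obtain m where "m \<ge> Suc i" "f m = Some y"
          "\<forall>l. Suc i \<le> l \<longrightarrow> l < m \<longrightarrow> f l = None"
        using Suc.hyps(1) by blast
      with None show ?thesis
        by (intro exI[of _ m]) (metis Suc_leD Suc_leI le_neq_implies_less)
    next
      case (Some z)
      with Suc.prems e show ?thesis by (intro exI[of _ i]) auto
    qed
  qed
  then show ?thesis using that by blast
qed

section \<open>Connected sets and components\<close>

locale coloured_graph =
  fixes V :: "'v set" and E :: "('v \<times> 'v) set" and t :: "'v \<Rightarrow> 'c"
  assumes finite_V: "finite V" and E_subset: "E \<subseteq> V \<times> V" and sym_E: "sym E"
    and irrefl_E: "(v, v) \<notin> E"
begin

text \<open>The elementary counterpart of \<open>connected_set\<close>;
  \<open>connected_set_iff\<close> identifies the two.\<close>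

definition conn :: "'v set \<Rightarrow> bool" where
  "conn A \<longleftrightarrow> A \<noteq> {} \<and> A \<subseteq> V \<and> (\<forall>u \<in> A. \<forall>v \<in> A. (u, v) \<in> (Restr E A)\<^sup>*)"

definition component :: "'v set \<Rightarrow> 'v \<Rightarrow> 'v set" where
  "component X v = {u. (v, u) \<in> (Restr E X)\<^sup>*}"

lemma E_sym_iff: "(u, v) \<in> E \<longleftrightarrow> (v, u) \<in> E"
  using sym_E by (meson symD)

lemma sym_Restr: "sym ((Restr E X)\<^sup>*)"
  by (rule sym_rtrancl) (use E_sym_iff in \<open>auto simp: sym_def\<close>)

lemma component_self [simp]: "v \<in> component X v"
  by (simp add: component_def)

lemma component_subset: "v \<in> X \<Longrightarrow> component X v \<subseteq> X"
proof
  fix u assume v: "v \<in> X" and "u \<in> component X v"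
  then have "(v, u) \<in> (Restr E X)\<^sup>*" by (simp add: component_def)
  then show "u \<in> X" by (cases rule: rtranclE) (use v in auto)
qed

lemma component_closed: "u \<in> component X v \<Longrightarrow> v \<in> X \<Longrightarrow> (u, w) \<in> E \<Longrightarrow> w \<in> X \<Longrightarrow> w \<in> component X v"
  using component_subset[of v X] unfolding component_def by (auto intro: rtrancl_into_rtrancl)

lemma component_least:
  assumes "v \<in> S" "\<And>u w. u \<in> S \<Longrightarrow> (u, w) \<in> E \<Longrightarrow> u \<in> X \<Longrightarrow> w \<in> X \<Longrightarrow> w \<in> S"
  shows "component X v \<subseteq> S"
proof
  fix u assume "u \<in> component X v"
  then have "(v, u) \<in> (Restr E X)\<^sup>*" by (simp add: component_def)
  then show "u \<in> S" by induction (use assms in auto)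
qed

text \<open>A path in \<open>X\<close> from \<open>v\<close> never leaves the component of
  \<open>v\<close>, so it is also a path inside the component; symmetry then joins any two vertices
  through \<open>v\<close>.\<close>

lemma conn_component:
  assumes "v \<in> X" "X \<subseteq> V"
  shows "conn (component X v)"
proof -
  let ?A = "component X v"
  have "(v, u) \<in> (Restr E ?A)\<^sup>*" if "u \<in> ?A" for u
  proof -
    have "(v, u) \<in> (Restr E X)\<^sup>*" using that by (simp add: component_def)
    then show ?thesis
    proof (induction rule: rtrancl_induct)
      case (step y z)
      then have "y \<in> ?A" "z \<in> ?A" by (auto simp: component_def intro: rtrancl_into_rtrancl)
      with step show ?case by (auto intro: rtrancl_into_rtrancl)
    qed simp
  qed
  moreover from this have "(u, v) \<in> (Restr E ?A)\<^sup>*" if "u \<in> ?A" for u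
    using that sym_Restr by (meson symD)
  ultimately have "\<forall>u \<in> ?A. \<forall>w \<in> ?A. (u, w) \<in> (Restr E ?A)\<^sup>*"
    by (meson rtrancl_trans)
  then show ?thesis
    using component_subset[OF assms(1)] assms(2) component_self unfolding conn_def by blast
qed

lemma conn_subset_component:
  assumes "conn A" "A \<subseteq> X" "v \<in> A"
  shows "A \<subseteq> component X v"
proof
  fix u assume "u \<in> A"
  then have "(v, u) \<in> (Restr E A)\<^sup>*" using assms by (auto simp: conn_def)
  moreover have "Restr E A \<subseteq> Restr E X" using assms(2) by auto
  ultimately show "u \<in> component X v" unfolding component_def using rtrancl_mono by blast
qed

lemma conn_singleton: "v \<in> V \<Longrightarrow> conn {v}"
  by (auto simp: conn_def)

text \<open>\<open>D\<close> serves as a hub: the component of one of its vertices in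
  \<open>D \<union> B\<close> swallows everything. When \<open>D\<close> is dominating, any part of
  a colour class can be attached to it in this way.\<close>

lemma conn_extend:
  assumes "conn D" "B \<subseteq> V" "\<And>x. x \<in> B \<Longrightarrow> \<exists>y \<in> D. (y, x) \<in> E"
  shows "conn (D \<union> B)"
proof -
  obtain v where v: "v \<in> D" using assms(1) by (auto simp: conn_def)
  have DV: "D \<subseteq> V" using assms(1) by (auto simp: conn_def)
  have D: "D \<subseteq> component (D \<union> B) v" by (rule conn_subset_component) (use assms v in auto)
  have "B \<subseteq> component (D \<union> B) v"
  proof
    fix x assume "x \<in> B"
    then obtain y where "y \<in> D" "(y, x) \<in> E" using assms(3) by blast
    then show "x \<in> component (D \<union> B) v"
      using D component_closed[of y "D \<union> B" v x] v \<open>x \<in> B\<close> by auto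
  qed
  then have "component (D \<union> B) v = D \<union> B" using D component_subset[of v "D \<union> B"] v by auto
  then show ?thesis using conn_component[of v "D \<union> B"] v DV assms(2) by auto
qed

text \<open>The closed subsets of \<open>V\<close> are the unions of connected components.\<close>

definition edge_closed :: "'v set \<Rightarrow> bool" where
  "edge_closed K \<longleftrightarrow> E `` K \<subseteq> K"

lemma conn_in_closed:
  assumes "edge_closed K" "conn A" "A \<inter> K \<noteq> {}"
  shows "A \<subseteq> K"
proof
  obtain v where v: "v \<in> A" "v \<in> K" using assms(3) by auto
  fix u assume "u \<in> A"
  then have "(v, u) \<in> (Restr E A)\<^sup>*" using v assms by (auto simp: conn_def)
  then show "u \<in> K" by induction (use v assms(1) in \<open>auto simp: edge_closed_def\<close>)
qed

lemma closed_component: "v \<in> V \<Longrightarrow> edge_closed (component V v)"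
  unfolding edge_closed_def using component_closed[of _ V v] E_subset by auto

lemma closed_disjoint_component:
  assumes "edge_closed K" "v \<in> V - K"
  shows "component V v \<inter> K = {}"
proof -
  have "component V v \<subseteq> V - K"
    by (rule component_least) (use assms E_sym_iff in \<open>auto simp: edge_closed_def\<close>)
  then show ?thesis by auto
qed

section \<open>Backward completions and maximal strokes\<close>

text \<open>
  Read backwards, a paint plan turns more and more vertices into wildcards (the set \<open>W\<close>), and a
  stroke is admissible if it is monochromatic outside \<open>W\<close>.
\<close>

primrec completes :: "'v set \<Rightarrow> ('v, 'c) stroke list \<Rightarrow> bool" where
  "completes W [] \<longleftrightarrow> V \<subseteq> W"
| "completes W (s # ss) \<longleftrightarrow>
     conn (fst s) \<and> (\<forall>v \<in> fst s - W. t v = snd s) \<and> completes (W \<union> fst s) ss"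

lemma completes_conn: "completes W ss \<Longrightarrow> \<forall>s \<in> set ss. conn (fst s)"
  by (induction ss arbitrary: W) auto

definition ncols :: "'v set \<Rightarrow> nat" where
  "ncols W = card (t ` (V - W))"

lemma ncols_antimono: "W \<subseteq> W' \<Longrightarrow> ncols W' \<le> ncols W"
  unfolding ncols_def by (rule card_mono) (use finite_V in auto)

lemma ncols_eq_0_iff: "ncols W = 0 \<longleftrightarrow> V \<subseteq> W"
  unfolding ncols_def using finite_V by auto

text \<open>The same strokes work: with more wildcards, each of them has fewer vertices on which its
  colour must agree with \<open>t\<close>.\<close>

lemma completes_mono: "completes W ss \<Longrightarrow> W \<subseteq> W' \<Longrightarrow> completes W' ss"
proof (induction ss arbitrary: W W')
  case (Cons s ss)
  then show ?case using Cons.IH[of "W \<union> fst s" "W' \<union> fst s"] by auto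
qed auto

text \<open>A stroke can exhaust at most one colour, its own.\<close>

lemma ncols_le_length: "completes W ss \<Longrightarrow> ncols W \<le> length ss"
proof (induction ss arbitrary: W)
  case Nil
  then show ?case using ncols_eq_0_iff by simp
next
  case (Cons s ss)
  have "t ` (V - W) \<subseteq> insert (snd s) (t ` (V - (W \<union> fst s)))"
    using Cons.prems by auto
  then have "ncols W \<le> card (insert (snd s) (t ` (V - (W \<union> fst s))))"
    unfolding ncols_def by (intro card_mono) (use finite_V in auto)
  also have "\<dots> \<le> Suc (ncols (W \<union> fst s))"
    unfolding ncols_def by (rule card_insert_le_m1) (use finite_V in auto)
  finally show ?case using Cons by fastforce
qed

text \<open>
  Exchange argument: a colour that can be finished right away may be finished right away, because
  every plan still spends a stroke of that colour, which becomes superfluous.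
\<close>

lemma completes_finish:
  assumes "completes W ss" "v \<in> V - W" "{u \<in> V. t u = t v} \<subseteq> W \<union> S"
  shows "\<exists>ss'. length ss = Suc (length ss') \<and> completes (W \<union> S) ss'"
  using assms
proof (induction ss arbitrary: W)
  case (Cons s ss)
  show ?case
  proof (cases "snd s = t v")
    case True
    have "fst s \<subseteq> V" using Cons.prems by (auto simp: conn_def)
    then have "W \<union> fst s \<subseteq> W \<union> S" using Cons.prems True by auto
    then have "completes (W \<union> S) ss" using Cons.prems(1) completes_mono by auto
    then show ?thesis by auto
  next
    case False
    then have "v \<in> V - (W \<union> fst s)" using Cons.prems by auto
    then obtain ss' where "length ss = Suc (length ss')" "completes (W \<union> fst s \<union> S) ss'"
      using Cons.IH[of "W \<union> fst s"] Cons.prems by auto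
    then show ?thesis
      using Cons.prems by (intro exI[of _ "s # ss'"]) (auto simp: Un_ac)
  qed
qed auto

text \<open>Every connected set through \<open>v\<close> that has colour \<open>t v\<close> outside
  \<open>W\<close> lies in this one, so it is the largest admissible stroke of that colour at
  \<open>v\<close>.\<close>

definition stroke :: "'v set \<Rightarrow> 'v \<Rightarrow> 'v set" where
  "stroke W v = component (W \<union> {u \<in> V. t u = t v}) v"

definition finishing :: "'v set \<Rightarrow> 'v \<Rightarrow> bool" where
  "finishing W v \<longleftrightarrow> v \<notin> W \<and> {u \<in> V. t u = t v} \<subseteq> W \<union> stroke W v"

lemma stroke_self [simp]: "v \<in> stroke W v"
  by (simp add: stroke_def)

lemma stroke_subset: "v \<in> V \<Longrightarrow> stroke W v \<subseteq> W \<union> {u \<in> V. t u = t v}"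
  unfolding stroke_def by (rule component_subset) auto

lemma stroke_subset_V: "v \<in> V \<Longrightarrow> W \<subseteq> V \<Longrightarrow> stroke W v \<subseteq> V"
  using stroke_subset[of v W] by auto

lemma conn_stroke: "v \<in> V \<Longrightarrow> W \<subseteq> V \<Longrightarrow> conn (stroke W v)"
  unfolding stroke_def by (rule conn_component) auto

text \<open>Strokes inside \<open>W\<close> achieve nothing and are skipped. The first one that
  leaves \<open>W\<close>, say at \<open>v\<close>, is contained in \<open>stroke W v\<close>, so by
  monotonicity the maximal stroke can replace it.\<close>

lemma completes_branch:
  assumes "completes W ss" "\<not> V \<subseteq> W"
  shows "\<exists>v \<in> V - W. \<exists>ss'. length ss' < length ss \<and> completes (W \<union> stroke W v) ss'"
  using assms
proof (induction ss arbitrary: W)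
  case (Cons s ss)
  have sV: "fst s \<subseteq> V" "conn (fst s)" using Cons.prems by (auto simp: conn_def)
  show ?case
  proof (cases "fst s \<subseteq> W")
    case True
    then have "W \<union> fst s = W" by auto
    then obtain v ss' where "v \<in> V - W" "length ss' < length ss" "completes (W \<union> stroke W v) ss'"
      using Cons.IH[of W] Cons.prems by auto
    then show ?thesis by (intro bexI[of _ v] exI[of _ ss']) auto
  next
    case False
    then obtain v where v: "v \<in> fst s" "v \<notin> W" by auto
    then have "fst s \<subseteq> stroke W v"
      unfolding stroke_def using Cons.prems sV by (intro conn_subset_component) auto
    then have "completes (W \<union> stroke W v) ss"
      using Cons.prems completes_mono[of "W \<union> fst s" ss "W \<union> stroke W v"] by auto
    then show ?thesis using v sV by (intro bexI[of _ v] exI[of _ ss]) auto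
  qed
qed auto

lemma ncols_finishing:
  assumes "finishing W v" "v \<in> V"
  shows "ncols W = Suc (ncols (W \<union> stroke W v))"
proof -
  have "t ` (V - W) = insert (t v) (t ` (V - (W \<union> stroke W v)))"
    using assms stroke_subset[of v W] unfolding finishing_def by auto
  moreover have "t v \<notin> t ` (V - (W \<union> stroke W v))"
    using assms unfolding finishing_def by auto
  ultimately show ?thesis unfolding ncols_def using finite_V by simp
qed

text \<open>Some vertex of the colour stays uncovered, and no other colour is touched outside
  \<open>W\<close>. Such a stroke leaves the lower bound where it was and counts as excess.\<close>

lemma ncols_not_finishing:
  assumes "\<not> finishing W v" "v \<in> V - W"
  shows "ncols (W \<union> stroke W v) = ncols W"
proof -
  obtain u where u: "u \<in> V - (W \<union> stroke W v)" "t u = t v"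
    using assms unfolding finishing_def by auto
  have "t x \<in> t ` (V - (W \<union> stroke W v))" if "x \<in> V - W" for x
  proof (cases "x \<in> stroke W v")
    case True
    then have "t x = t u" using that assms u(2) stroke_subset[of v W] by auto
    then show ?thesis using u(1) by simp
  next
    case False
    then show ?thesis using that by simp
  qed
  then have "t ` (V - W) = t ` (V - (W \<union> stroke W v))" by auto
  then show ?thesis unfolding ncols_def by simp
qed

text \<open>Stronger than \<open>completes\<close>: the exact final set lets plans be concatenated,
  the condition \<open>\<not> fst s \<subseteq> W\<close> keeps the plan for a component inside that
  component, and the condition on \<open>snd s\<close> keeps it within the colours of the
  template.\<close>

primrec legal :: "'v set \<Rightarrow> ('v, 'c) stroke list \<Rightarrow> 'v set \<Rightarrow> bool" where
  "legal W [] W' \<longleftrightarrow> W' = W"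
| "legal W (s # ss) W' \<longleftrightarrow>
     conn (fst s) \<and> snd s \<in> t ` V \<and> \<not> fst s \<subseteq> W \<and> (\<forall>v \<in> fst s - W. t v = snd s) \<and>
     legal (W \<union> fst s) ss W'"

lemma legal_append: "legal W (xs @ ys) W'' \<longleftrightarrow> (\<exists>W'. legal W xs W' \<and> legal W' ys W'')"
  by (induction xs arbitrary: W) auto

lemma legal_completes: "legal W ss V \<Longrightarrow> completes W ss"
  by (induction ss arbitrary: W) auto

lemma legal_stroke:
  "s \<in> set ss \<Longrightarrow> legal W ss W' \<Longrightarrow> conn (fst s) \<and> snd s \<in> t ` V \<and> \<not> fst s \<subseteq> W"
  by (induction ss arbitrary: W) auto

text \<open>This lets the plan of one component run while the vertices of another, which it never
  touches, are not yet wildcards.\<close>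

lemma legal_Diff:
  assumes "legal W ss W'" "\<forall>s \<in> set ss. fst s \<inter> X = {}"
  shows "legal (W - X) ss (W' - X)"
  using assms
proof (induction ss arbitrary: W)
  case (Cons s ss)
  have "W - X \<union> fst s = (W \<union> fst s) - X" using Cons.prems by auto
  then show ?case using Cons by auto
qed auto

text \<open>Strokes are found from last to first and put in front of \<open>acc\<close>, so the
  accumulator is in painting order. The number is fuel: every round finishes a colour, hence
  \<open>ncols W\<close> rounds suffice.\<close>

primrec greedy :: "'v list \<Rightarrow> nat \<Rightarrow> 'v set \<Rightarrow> ('v, 'c) stroke list \<Rightarrow> 'v set \<times> ('v, 'c) stroke list"
where
  "greedy vs 0 W acc = (W, acc)"
| "greedy vs (Suc m) W acc =
     (case find (finishing W) vs of
        None \<Rightarrow> (W, acc)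
      | Some v \<Rightarrow> greedy vs m (W \<union> stroke W v) ((stroke W v, t v) # acc))"

text \<open>Each round applies \<open>completes_finish\<close> to an arbitrary competitor, which
  thereby loses exactly one stroke. The last conjunct records this; it is the optimality of the
  greedy phase.\<close>

lemma greedy_correct:
  assumes "set vs = V" "W \<subseteq> V" "ncols W \<le> m" "greedy vs m W acc = (W', acc')"
  shows "\<exists>pl. acc' = rev pl @ acc \<and> legal W pl W' \<and> W' \<subseteq> V \<and> W \<subseteq> W' \<and>
    (\<forall>v \<in> V. \<not> finishing W' v) \<and> length pl + ncols W' = ncols W \<and>
    (\<forall>ss. completes W ss \<longrightarrow> (\<exists>ss'. completes W' ss' \<and> length ss' + length pl = length ss))"
  using assms
proof (induction m arbitrary: W acc)
  case 0
  then have "V \<subseteq> W" using ncols_eq_0_iff by auto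
  then have "\<forall>v \<in> V. \<not> finishing W v" by (auto simp: finishing_def)
  with 0 show ?case by (intro exI[of _ "[]"]) auto
next
  case (Suc m)
  show ?case
  proof (cases "find (finishing W) vs")
    case None
    then have "\<forall>v \<in> V. \<not> finishing W v" using Suc.prems(1) by (auto simp: find_None_iff)
    with None Suc show ?thesis by (intro exI[of _ "[]"]) auto
  next
    case (Some v)
    then have v: "v \<in> V" "finishing W v" using Suc.prems(1) by (auto simp: find_Some_iff)
    let ?S = "stroke W v"
    have n: "ncols W = Suc (ncols (W \<union> ?S))" using v ncols_finishing by auto
    have g: "greedy vs m (W \<union> ?S) ((?S, t v) # acc) = (W', acc')" using Suc.prems Some by simp
    have S: "?S \<subseteq> V" using v Suc.prems stroke_subset_V by auto
    obtain pl where pl: "acc' = rev pl @ (?S, t v) # acc" "legal (W \<union> ?S) pl W'" "W' \<subseteq> V"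
      "W \<union> ?S \<subseteq> W'" "\<forall>v \<in> V. \<not> finishing W' v" "length pl + ncols W' = ncols (W \<union> ?S)"
      "\<And>ss. completes (W \<union> ?S) ss \<Longrightarrow> \<exists>ss'. completes W' ss' \<and> length ss' + length pl = length ss"
      using Suc.IH[OF Suc.prems(1) _ _ g] S n Suc.prems by auto
    have "legal W ((?S, t v) # pl) W'"
      using pl(2) v stroke_subset[of v W] conn_stroke[of v W] Suc.prems stroke_self[of v W]
      unfolding finishing_def by (auto simp del: stroke_self)
    moreover have "\<exists>ss'. completes W' ss' \<and> length ss' + length ((?S, t v) # pl) = length ss"
      if c: "completes W ss" for ss
    proof -
      obtain ss1 where "length ss = Suc (length ss1)" "completes (W \<union> ?S) ss1"
        using completes_finish[OF c, of v ?S] v unfolding finishing_def by auto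
      then show ?thesis using pl(7) by fastforce
    qed
    ultimately show ?thesis using pl n by (intro exI[of _ "(?S, t v) # pl"]) auto
  qed
qed

section \<open>Search with a bounded excess\<close>

text \<open>
  The parameter \<open>d\<close> bounds the number of strokes that do not finish a colour, i.e. the number of
  strokes in excess of the trivial lower bound \<open>ncols W\<close>.
\<close>

primrec solve ::
    "'v list \<Rightarrow> nat \<Rightarrow> 'v set \<Rightarrow> ('v, 'c) stroke list \<Rightarrow> ('v, 'c) stroke list option"
where
  "solve vs 0 W acc =
     (case greedy vs (length vs) W acc of (W', acc') \<Rightarrow> if V \<subseteq> W' then Some acc' else None)"
| "solve vs (Suc d) W acc =
     (case greedy vs (length vs) W acc of (W', acc') \<Rightarrow>
        if V \<subseteq> W' then Some acc'
        else first_some (\<lambda>v. if v \<in> W' then None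
                             else solve vs d (W' \<union> stroke W' v) ((stroke W' v, t v) # acc')) vs)"

text \<open>Makes \<open>length vs\<close> enough fuel for \<open>greedy\<close>.\<close>

lemma ncols_le_length_list: "set vs = V \<Longrightarrow> ncols W \<le> length vs"
  unfolding ncols_def
  by (metis Diff_subset List.finite_set card_image_le card_length card_mono dual_order.trans
      finite_Diff)

text \<open>The two outcomes are complementary certificates: failure bounds every completion from
  below, success exhibits a plan within the budget. After the greedy phase no vertex is finishing,
  so every further maximal stroke costs one unit of excess.\<close>

lemma solve_correct:
  assumes "set vs = V" "W \<subseteq> V"
  shows "case solve vs d W acc of
      None \<Rightarrow> \<forall>ss. completes W ss \<longrightarrow> ncols W + d < length ss
    | Some acc' \<Rightarrow> \<exists>pl. acc' = rev pl @ acc \<and> legal W pl V \<and> length pl \<le> ncols W + d"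
  using assms
proof (induction d arbitrary: W acc)
  case 0
  obtain W' acc' where g: "greedy vs (length vs) W acc = (W', acc')" by fastforce
  obtain pl where pl: "acc' = rev pl @ acc" "legal W pl W'" "W' \<subseteq> V"
      "W \<subseteq> W'" "\<forall>v \<in> V. \<not> finishing W' v" "length pl + ncols W' = ncols W"
      "\<And>ss. completes W ss \<Longrightarrow> \<exists>ss'. completes W' ss' \<and> length ss' + length pl = length ss"
    using greedy_correct[OF 0(1,2) ncols_le_length_list[OF 0(1)] g] by blast
  show ?case
  proof (cases "V \<subseteq> W'")
    case True
    then have "legal W pl V" using pl(2,3) by (simp add: subset_antisym)
    then show ?thesis using g True pl(1,6) by auto
  next
    case False
    \<comment> \<open>The next useful stroke of a competitor keeps \<open>ncols\<close> fixed, so it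
      needs more than \<open>ncols W'\<close> strokes; those saved in the greedy phase make up the
      difference to \<open>ncols W\<close>.\<close>
    have "ncols W < length ss" if c: "completes W ss" for ss
    proof -
      obtain ss' where "completes W' ss'" and len: "length ss' + length pl = length ss"
        using pl(7)[OF c] by auto
      then obtain v ss'' where "v \<in> V - W'" "length ss'' < length ss'"
          "completes (W' \<union> stroke W' v) ss''"
        using completes_branch[of W' ss'] False by blast
      then show ?thesis
        using ncols_le_length ncols_not_finishing[of W' v] pl(5,6) len by fastforce
    qed
    then show ?thesis using g False by auto
  qed
next
  case (Suc d)
  obtain W' acc' where g: "greedy vs (length vs) W acc = (W', acc')" by fastforce
  obtain pl where pl: "acc' = rev pl @ acc" "legal W pl W'" "W' \<subseteq> V"
      "W \<subseteq> W'" "\<forall>v \<in> V. \<not> finishing W' v" "length pl + ncols W' = ncols W"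
      "\<And>ss. completes W ss \<Longrightarrow> \<exists>ss'. completes W' ss' \<and> length ss' + length pl = length ss"
    using greedy_correct[OF Suc.prems(1,2) ncols_le_length_list[OF Suc.prems(1)] g] by blast
  show ?case
  proof (cases "V \<subseteq> W'")
    case True
    then have "legal W pl V" using pl(2,3) by (simp add: subset_antisym)
    then show ?thesis using g True pl(1,6) by auto
  next
    case False
    let ?f = "\<lambda>v. if v \<in> W' then None
                  else solve vs d (W' \<union> stroke W' v) ((stroke W' v, t v) # acc')"
    have IH: "case solve vs d (W' \<union> stroke W' v) ((stroke W' v, t v) # acc') of
        None \<Rightarrow> \<forall>ss. completes (W' \<union> stroke W' v) ss \<longrightarrow> ncols W' + d < length ss
      | Some acc'' \<Rightarrow> \<exists>pl'. acc'' = rev pl' @ (stroke W' v, t v) # acc' \<and>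
          legal (W' \<union> stroke W' v) pl' V \<and> length pl' \<le> ncols W' + d"
      if "v \<in> V - W'" for v
    proof -
      have "ncols (W' \<union> stroke W' v) = ncols W'"
        using that ncols_not_finishing[of W' v] pl(5) by blast
      moreover have "W' \<union> stroke W' v \<subseteq> V"
        using that pl(3) stroke_subset_V[of v W'] by blast
      ultimately show ?thesis
        using Suc.IH[OF Suc.prems(1), of "W' \<union> stroke W' v" "(stroke W' v, t v) # acc'"]
        by (simp only:)
    qed
    have s: "solve vs (Suc d) W acc = first_some ?f vs" using g False by simp
    show ?thesis
    proof (cases "first_some ?f vs")
      case None
      have "ncols W + Suc d < length ss" if c: "completes W ss" for ss
      proof -
        obtain ss' where "completes W' ss'" and len: "length ss' + length pl = length ss"
          using pl(7)[OF c] by auto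
        then obtain v ss'' where v: "v \<in> V - W'" "length ss'' < length ss'"
            "completes (W' \<union> stroke W' v) ss''"
          using completes_branch[of W' ss'] False by blast
        moreover have "solve vs d (W' \<union> stroke W' v) ((stroke W' v, t v) # acc') = None"
          using None v(1) Suc.prems(1) by (auto simp: first_some_None_iff)
        \<comment> \<open>Passing to \<open>ss''\<close> lost \<open>length pl\<close> strokes to
          the greedy phase and at least one to the branching; adding them back turns
          \<open>d\<close> into \<open>Suc d\<close>.\<close>
        ultimately have "ncols W' + d < length ss''" using IH[of v] by simp
        then show ?thesis using v(2) len pl(6) by simp
      qed
      then show ?thesis using s None by simp
    next
      case (Some r)
      then have "\<exists>v \<in> set vs. ?f v = Some r"
        by (rule first_some_SomeD)
      then obtain v where v: "v \<in> V" "v \<notin> W'"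
          "solve vs d (W' \<union> stroke W' v) ((stroke W' v, t v) # acc') = Some r"
        using Suc.prems(1) by (auto split: if_splits)
      then obtain pl' where pl': "r = rev pl' @ (stroke W' v, t v) # acc'"
          "legal (W' \<union> stroke W' v) pl' V" "length pl' \<le> ncols W' + d"
        using IH[of v] by auto
      have "legal W' ((stroke W' v, t v) # pl') V"
        using pl'(2) v stroke_subset[of v W'] conn_stroke[of v W'] pl(3) stroke_self[of v W']
        by (auto simp del: stroke_self)
      then have "legal W (pl @ (stroke W' v, t v) # pl') V"
        using pl(2) legal_append by blast
      then show ?thesis using s Some pl' pl(1,6)
        by (auto intro!: exI[of _ "pl @ (stroke W' v, t v) # pl'"])
    qed
  qed
qed

text \<open>The budgets 0 to 4 are enough by \<open>few_extra_strokes\<close>.\<close>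

definition deepen :: "'v list \<Rightarrow> 'v set \<Rightarrow> ('v, 'c) stroke list \<Rightarrow> ('v, 'c) stroke list option" where
  "deepen vs W acc = first_some (\<lambda>d. solve vs d W acc) [0..<5]"

text \<open>If \<open>m\<close> is the first budget that succeeds, the failure of
  \<open>m - 1\<close> shows that every completion has at least \<open>ncols W + m\<close> strokes,
  which the plan found does not exceed. For \<open>m = 0\<close> the lower bound is
  \<open>ncols_le_length\<close>. The witness \<open>ss0\<close> rules out that all budgets
  fail.\<close>

lemma deepen_correct:
  assumes "set vs = V" "W \<subseteq> V" "completes W ss0" "length ss0 \<le> ncols W + 4"
  shows "\<exists>pl. deepen vs W acc = Some (rev pl @ acc) \<and> legal W pl V \<and>
    (\<forall>ss. completes W ss \<longrightarrow> length pl \<le> length ss)"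
proof (cases "deepen vs W acc")
  case None
  then have "solve vs 4 W acc = None" unfolding deepen_def first_some_None_iff by simp
  then show ?thesis using solve_correct[OF assms(1,2), of 4 acc] assms(3,4) by fastforce
next
  case (Some r)
  then obtain m where m: "solve vs m W acc = Some r" "\<forall>l. l < m \<longrightarrow> solve vs l W acc = None"
    unfolding deepen_def using first_some_upt_SomeD[of "\<lambda>d. solve vs d W acc" 0 5 r] by auto
  then obtain pl where pl: "r = rev pl @ acc" "legal W pl V" "length pl \<le> ncols W + m"
    using solve_correct[OF assms(1,2), of m acc] by auto
  have "length pl \<le> length ss" if c: "completes W ss" for ss
  proof (cases m)
    case 0
    then show ?thesis using ncols_le_length[OF c] pl(3) by simp
  next
    case (Suc l)
    then have "ncols W + l < length ss"
      using solve_correct[OF assms(1,2), of l acc] m(2) c by fastforce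
    then show ?thesis using pl(3) Suc by simp
  qed
  then show ?thesis using Some pl by blast
qed

section \<open>Decomposition into components\<close>

text \<open>Failure cannot happen on the graphs of interest; the value \<open>[]\<close> in that case is arbitrary.\<close>

primrec solve_all ::
    "'v list \<Rightarrow> 'v list \<Rightarrow> 'v set \<Rightarrow> ('v, 'c) stroke list \<Rightarrow> ('v, 'c) stroke list"
where
  "solve_all vs [] Done acc = acc"
| "solve_all vs (u # us) Done acc =
     (if u \<in> Done then solve_all vs us Done acc
      else case deepen vs (V - component V u) acc of
             None \<Rightarrow> []
           | Some acc' \<Rightarrow> solve_all vs us (Done \<union> component V u) acc')"

text \<open>Once everything outside \<open>K\<close> is a wildcard, a stroke that misses
  \<open>K\<close> adds nothing.\<close>

lemma completes_filter:
  assumes "edge_closed K" "completes W ss"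
  shows "completes (W \<union> (V - K)) (filter (\<lambda>s. fst s \<inter> K \<noteq> {}) ss)"
  using assms(2)
proof (induction ss arbitrary: W)
  case (Cons s ss)
  then have s: "conn (fst s)" "fst s \<subseteq> V" by (auto simp: conn_def)
  have IH: "completes (W \<union> fst s \<union> (V - K)) (filter (\<lambda>s. fst s \<inter> K \<noteq> {}) ss)"
    using Cons by auto
  show ?case
  proof (cases "fst s \<inter> K = {}")
    case True
    then have "W \<union> fst s \<union> (V - K) = W \<union> (V - K)" using s by auto
    then show ?thesis using IH True by simp
  next
    case False
    then show ?thesis using IH Cons.prems s by (auto simp: Un_ac)
  qed
qed auto

text \<open>Solving \<open>K\<close> alone means that all other vertices are wildcards;
  \<open>K = V\<close> is the original problem, with no wildcards at the start.\<close>

definition optimal_on :: "'v set \<Rightarrow> ('v, 'c) stroke list \<Rightarrow> bool" where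
  "optimal_on K ss \<longleftrightarrow>
     legal (V - K) ss V \<and> (\<forall>ss'. completes (V - K) ss' \<longrightarrow> length ss \<le> length ss')"

text \<open>For the lower bound, a competitor is split into the strokes that meet \<open>D\<close>
  and those that meet \<open>K\<close>. No stroke is counted twice, because a connected set that
  meets an edge-closed set lies inside it.\<close>

lemma optimal_on_append:
  assumes D: "edge_closed D" "D \<subseteq> V" "optimal_on D xs" and K: "edge_closed K" "K \<subseteq> V" "optimal_on K ys"
    and disj: "D \<inter> K = {}"
  shows "optimal_on (D \<union> K) (xs @ ys)"
proof -
  have "fst s \<inter> K = {}" if "s \<in> set xs" for s
  proof -
    have s: "conn (fst s)" "\<not> fst s \<subseteq> V - D"
      using legal_stroke[OF that] D(3) unfolding optimal_on_def by auto
    then have "fst s \<subseteq> D" using conn_in_closed[OF D(1) s(1)] by (auto simp: conn_def)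
    then show ?thesis using disj by auto
  qed
  then have "legal (V - D - K) xs (V - K)"
    using D(3) legal_Diff unfolding optimal_on_def by blast
  then have "legal (V - (D \<union> K)) (xs @ ys) V"
    using K(3) unfolding legal_append optimal_on_def by (auto simp: Diff_Un Diff_eq Int_ac)
  moreover have "length (xs @ ys) \<le> length ss" if c: "completes (V - (D \<union> K)) ss" for ss
  proof -
    let ?in = "\<lambda>K s. fst s \<inter> K \<noteq> {}"
    have "V - (D \<union> K) \<union> (V - D) = V - D" "V - (D \<union> K) \<union> (V - K) = V - K" by auto
    then have "length xs \<le> length (filter (?in D) ss)" "length ys \<le> length (filter (?in K) ss)"
      using completes_filter[OF D(1) c] completes_filter[OF K(1) c] D(3) K(3)
      unfolding optimal_on_def by auto
    moreover have "length (filter (?in D) ss) + length (filter (?in K) ss) \<le> length ss"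
      if "\<forall>s \<in> set ss. conn (fst s)"
      using that
    proof (induction ss)
      case (Cons s ss)
      have "\<not> (?in D s \<and> ?in K s)"
        using conn_in_closed[OF D(1)] conn_in_closed[OF K(1)] Cons.prems disj by fastforce
      then show ?case using Cons by auto
    qed auto
    ultimately show ?thesis using completes_conn[OF c] by force
  qed
  ultimately show ?thesis unfolding optimal_on_def by blast
qed

text \<open>Hypothesis \<open>ex\<close> excludes the failure branch of \<open>solve_all\<close>;
  the invariant is that \<open>Done\<close> is a union of components with an optimal plan in
  \<open>acc\<close>.\<close>

lemma solve_all_correct:
  assumes vs: "set vs = V"
    and ex: "\<And>v. v \<in> V \<Longrightarrow> \<exists>ss. completes (V - component V v) ss \<and> length ss \<le> ncols (V - component V v) + 4"
    and "set us \<subseteq> V" "edge_closed Done" "Done \<subseteq> V" "V \<subseteq> Done \<union> set us" "optimal_on Done (rev acc)"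
  shows "optimal_on V (rev (solve_all vs us Done acc))"
  using assms(3-)
proof (induction us arbitrary: Done acc)
  case Nil
  then have "Done = V" by auto
  with Nil show ?case by simp
next
  case (Cons u us)
  show ?case
  proof (cases "u \<in> Done")
    case True
    then show ?thesis using Cons by auto
  next
    case False
    let ?K = "component V u"
    have u: "u \<in> V" using Cons.prems by simp
    have KV: "?K \<subseteq> V" using component_subset[OF u] .
    obtain pl where pl: "deepen vs (V - ?K) acc = Some (rev pl @ acc)" "optimal_on ?K pl"
      using ex[OF u] deepen_correct[OF vs, of "V - ?K"] unfolding optimal_on_def by blast
    have disj: "Done \<inter> ?K = {}"
      using closed_disjoint_component[of Done u] Cons.prems False u by auto
    have "optimal_on (Done \<union> ?K) (rev (rev pl @ acc))"
      using optimal_on_append[OF _ _ _ closed_component[OF u] KV pl(2) disj] Cons.prems by simp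
    moreover have "edge_closed (Done \<union> ?K)"
      using closed_component[OF u] Cons.prems by (auto simp: edge_closed_def)
    ultimately have "optimal_on V (rev (solve_all vs us (Done \<union> ?K) (rev pl @ acc)))"
      by (intro Cons.IH) (use Cons.prems KV in auto)
    then show ?thesis using False pl by simp
  qed
qed

end

section \<open>Dominating sets in co-gem-free graphs\<close>

context coloured_graph
begin

text \<open>\<open>D\<close> can be made wildcards at the price of \<open>m\<close> further strokes.
  The price must not depend on the current wildcards, so that \<open>D\<close> can be bought vertex
  by vertex.\<close>

definition affordable :: "'v set \<Rightarrow> nat \<Rightarrow> bool" where
  "affordable D m \<longleftrightarrow> conn D \<and>
     (\<forall>W ss. completes (W \<union> D) ss \<longrightarrow> (\<exists>ss'. completes W ss' \<and> length ss' \<le> length ss + m))"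

lemma affordable_singleton:
  assumes "v \<in> V"
  shows "affordable {v} 1"
proof -
  have "\<exists>ss'. completes W ss' \<and> length ss' \<le> length ss + 1" if "completes (W \<union> {v}) ss" for W ss
    using that assms by (intro exI[of _ "({v}, t v) # ss"]) (auto simp: conn_singleton)
  then show ?thesis using assms conn_singleton by (auto simp: affordable_def)
qed

text \<open>Where \<open>D\<close> consists of wildcards, a stroke over \<open>insert x D\<close> is
  constrained only at \<open>x\<close>, so it may take the colour of \<open>x\<close>.\<close>

lemma affordable_insert:
  assumes D: "affordable D m" and x: "y \<in> D" "(y, x) \<in> E"
  shows "affordable (insert x D) (Suc m)"
proof -
  have conn: "conn (insert x D)"
    using conn_extend[of D "{x}"] D x E_subset by (auto simp: affordable_def)
  have "\<exists>ss'. completes W ss' \<and> length ss' \<le> length ss + Suc m"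
    if ss: "completes (W \<union> insert x D) ss" for W ss
  proof -
    have "W \<union> insert x D = W \<union> D \<union> insert x D" by auto
    then have "completes (W \<union> D) ((insert x D, t x) # ss)" using ss conn by auto
    then show ?thesis using D unfolding affordable_def by fastforce
  qed
  with conn show ?thesis unfolding affordable_def by blast
qed

lemma completes_dominating:
  assumes "conn D" "D \<subseteq> W" "V \<subseteq> W \<union> E `` D"
  shows "\<exists>ss. completes W ss \<and> length ss \<le> ncols W"
  using assms(2-)
proof (induction "ncols W" arbitrary: W)
  case 0
  then show ?case using ncols_eq_0_iff[of W] by (intro exI[of _ "[]"]) auto
next
  case (Suc m)
  then have "\<not> V \<subseteq> W" using ncols_eq_0_iff[of W] by auto
  then obtain v where v: "v \<in> V - W" by auto
  define B where "B = {u \<in> V - W. t u = t v}"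
  \<comment> \<open>\<open>D\<close> is free to take any colour and domination joins
    \<open>B\<close> to it, so one stroke exhausts the colour of \<open>v\<close>.\<close>
  have "conn (D \<union> B)"
    using assms(1) by (rule conn_extend) (use Suc.prems in \<open>auto simp: B_def\<close>)
  have "t ` (V - W) = insert (t v) (t ` (V - (W \<union> (D \<union> B))))"
    using Suc.prems v by (auto simp: B_def)
  moreover have "t v \<notin> t ` (V - (W \<union> (D \<union> B)))"
    by (auto simp: B_def)
  ultimately have n: "ncols W = Suc (ncols (W \<union> (D \<union> B)))"
    unfolding ncols_def using finite_V by simp
  then obtain ss where "completes (W \<union> (D \<union> B)) ss" "length ss \<le> ncols (W \<union> (D \<union> B))"
    using Suc(1)[of "W \<union> (D \<union> B)"] Suc(2) Suc.prems by auto
  then show ?case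
    using n \<open>conn (D \<union> B)\<close> Suc.prems(1)
    by (intro exI[of _ "(D \<union> B, t v) # ss"]) (auto simp: B_def)
qed

lemma completes_affordable:
  assumes "affordable D m" "V \<subseteq> W \<union> D \<union> E `` D"
  shows "\<exists>ss. completes W ss \<and> length ss \<le> ncols W + m"
proof -
  obtain ss where "completes (W \<union> D) ss" "length ss \<le> ncols (W \<union> D)"
    using completes_dominating[of D "W \<union> D"] assms by (auto simp: affordable_def)
  moreover have "ncols (W \<union> D) \<le> ncols W" by (rule ncols_antimono) auto
  ultimately show ?thesis using assms(1) unfolding affordable_def by fastforce
qed

text \<open>Consecutive vertices differ because \<open>E\<close> is irreflexive, so only the other
  three pairs need inequalities.\<close>

definition induced_P4 :: "'v \<Rightarrow> 'v \<Rightarrow> 'v \<Rightarrow> 'v \<Rightarrow> bool" where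
  "induced_P4 a b c d \<longleftrightarrow> (a, b) \<in> E \<and> (b, c) \<in> E \<and> (c, d) \<in> E \<and>
     (a, c) \<notin> E \<and> (a, d) \<notin> E \<and> (b, d) \<notin> E \<and> a \<noteq> c \<and> a \<noteq> d \<and> b \<noteq> d"

text \<open>
  An edge \<open>uv\<close> of the component with \<open>|N(u) \<union> N(v)|\<close> maximal is dominating: a vertex \<open>x\<close> at
  distance two from it would be adjacent to a common neighbour \<open>y\<close> of \<open>u\<close> and \<open>v\<close>, and then the
  edge \<open>uy\<close> would dominate strictly more.
\<close>

lemma P4_free_dominating_edge:
  assumes P4: "\<And>a b c d. \<not> induced_P4 a b c d" and v: "v \<in> V" and w: "(v, w) \<in> E"
  shows "\<exists>a b. (a, b) \<in> E \<and> component V v \<subseteq> E `` {a, b}"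
proof -
  let ?P = "\<lambda>(a, b). (a, b) \<in> E \<and> a \<in> component V v"
  have bound: "\<forall>p. ?P p \<longrightarrow> card (E `` {fst p, snd p}) < Suc (card V)"
  proof (intro allI impI)
    fix p
    have "E `` {fst p, snd p} \<subseteq> V" using E_subset by auto
    then show "card (E `` {fst p, snd p}) < Suc (card V)"
      using finite_V card_mono less_Suc_eq_le by blast
  qed
  have "\<exists>p. ?P p \<and> (\<forall>q. ?P q \<longrightarrow> card (E `` {fst q, snd q}) \<le> card (E `` {fst p, snd p}))"
    by (rule ex_has_greatest_nat[of ?P "(v, w)" _ "Suc (card V)"])
      (use w bound in \<open>auto simp: less_imp_le\<close>)
  then obtain a b where ab: "(a, b) \<in> E" "a \<in> component V v"
    and max: "\<And>c d. (c, d) \<in> E \<Longrightarrow> c \<in> component V v \<Longrightarrow>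
      card (E `` {c, d}) \<le> card (E `` {a, b})"
    by auto
  have bv: "b \<in> component V v" using ab v component_closed[of a V v b] E_subset by auto
  have key: False
    if e: "(p, q) \<in> E" and pq: "{p, q} = {a, b}" and y: "(p, y) \<in> E" "(y, x) \<in> E"
      and x: "(p, x) \<notin> E" "(q, x) \<notin> E" for p q x y
  proof -
    have pv: "p \<in> component V v" using pq ab bv by auto
    have xq: "x \<noteq> p" "x \<noteq> q" using e x E_sym_iff by auto
    have yq: "(q, y) \<in> E"
    proof (rule ccontr)
      assume "(q, y) \<notin> E"
      then have "induced_P4 x y p q"
        unfolding induced_P4_def using e y x xq E_sym_iff by metis
      then show False using P4 by blast
    qed
    \<comment> \<open>Otherwise the edge \<open>(p, y)\<close> would dominate all that
      \<open>(p, q)\<close> does and \<open>x\<close> as well, against maximality. This provides a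
      neighbour \<open>z\<close> of \<open>q\<close> that sees neither \<open>p\<close> nor
      \<open>y\<close>.\<close>
    have "\<not> E `` {p, q} \<subseteq> E `` {p, y}"
    proof
      assume "E `` {p, q} \<subseteq> E `` {p, y}"
      moreover have "x \<in> E `` {p, y}" "x \<notin> E `` {p, q}" using x y by auto
      moreover have "finite (E `` {p, y})"
        by (rule finite_subset[OF _ finite_V]) (use E_subset in auto)
      ultimately have "card (E `` {p, q}) < card (E `` {p, y})"
        by (intro psubset_card_mono) auto
      then show False using max[OF y(1) pv] pq by simp
    qed
    then obtain z where z: "(q, z) \<in> E" "(p, z) \<notin> E" "(y, z) \<notin> E" by auto
    have ne: "z \<noteq> y" "x \<noteq> q" "z \<noteq> x" "z \<noteq> p" using z yq xq x y E_sym_iff by metis+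
    \<comment> \<open>Without this edge, \<open>z q y x\<close> is an induced path; with it,
      \<open>z x y p\<close> is one.\<close>
    have "(z, x) \<in> E"
    proof (rule ccontr)
      assume "(z, x) \<notin> E"
      then have "induced_P4 z q y x"
        unfolding induced_P4_def using z yq y x ne E_sym_iff by metis
      then show False using P4 by blast
    qed
    then have "induced_P4 z x y p"
      unfolding induced_P4_def using z y x ne xq E_sym_iff by metis
    then show False using P4 by blast
  qed
  have "component V v \<subseteq> component V a"
  proof -
    have "conn (component V v)" using v by (intro conn_component) auto
    moreover have "component V v \<subseteq> V" using v component_subset by auto
    ultimately show ?thesis using ab(2) by (intro conn_subset_component) auto
  qed
  \<comment> \<open>The ends of an edge are neighbours of each other, so its neighbourhood contains
    \<open>a\<close>; by \<open>key\<close> it is closed under adjacency.\<close>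
  also have "component V a \<subseteq> E `` {a, b}"
  proof (rule component_least)
    show "a \<in> E `` {a, b}" using ab E_sym_iff by auto
  next
    fix y x assume y: "y \<in> E `` {a, b}" and yx: "(y, x) \<in> E"
    show "x \<in> E `` {a, b}"
    proof (rule ccontr)
      assume "x \<notin> E `` {a, b}"
      then show False
        using y yx ab(1) E_sym_iff key[of a b y x] key[of b a y x] by auto
    qed
  qed
  finally show ?thesis using ab(1) by blast
qed

text \<open>A vertex missed by an induced path on four vertices would be the isolated vertex of a
  co-gem.\<close>

definition no_co_gem :: bool where
  "no_co_gem \<longleftrightarrow> (\<forall>a b c d. induced_P4 a b c d \<longrightarrow> V \<subseteq> {a, b, c, d} \<union> E `` {a, b, c, d})"

text \<open>The price is one stroke per vertex of a connected set that dominates the component: four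
  for an induced path, two for a dominating edge, one if \<open>v\<close> is isolated.\<close>

lemma few_extra_strokes:
  assumes "no_co_gem" and v: "v \<in> V"
  shows "\<exists>ss. completes (V - component V v) ss \<and> length ss \<le> ncols (V - component V v) + 4"
proof -
  let ?K = "component V v"
  have "\<exists>D m. affordable D m \<and> m \<le> 4 \<and> ?K \<subseteq> D \<union> E `` D"
  proof (cases "\<exists>a b c d. induced_P4 a b c d")
    case True
    then obtain a b c d where P: "induced_P4 a b c d" by blast
    then have e: "(a, b) \<in> E" "(b, c) \<in> E" "(c, d) \<in> E" by (auto simp: induced_P4_def)
    then have "a \<in> V" using E_subset by auto
    then have "affordable {a} 1" by (rule affordable_singleton)
    then have "affordable {b, a} 2" using affordable_insert[of "{a}" 1 a b] e by (simp add: eval_nat_numeral)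
    then have "affordable {c, b, a} 3" using affordable_insert[of "{b, a}" 2 b c] e by (simp add: eval_nat_numeral)
    then have "affordable {d, c, b, a} 4" using affordable_insert[of "{c, b, a}" 3 c d] e by (simp add: eval_nat_numeral)
    moreover have "V \<subseteq> {d, c, b, a} \<union> E `` {d, c, b, a}"
      using assms(1) P unfolding no_co_gem_def by (simp add: insert_commute)
    moreover have "?K \<subseteq> V" using component_subset v by auto
    ultimately show ?thesis by (intro exI[of _ "{d, c, b, a}"] exI[of _ 4]) auto
  next
    case False
    show ?thesis
    proof (cases "\<exists>w. (v, w) \<in> E")
      case True
      then obtain a b where ab: "(a, b) \<in> E" "?K \<subseteq> E `` {a, b}"
        using P4_free_dominating_edge[OF _ v] False by blast
      have "affordable {a} 1" using ab E_subset by (intro affordable_singleton) auto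
      then have "affordable {b, a} 2" using affordable_insert[of "{a}" 1 a b] ab by (simp add: eval_nat_numeral)
      then show ?thesis using ab(2) by (intro exI[of _ "{b, a}"] exI[of _ 2]) auto
    next
      case False
      then have "?K \<subseteq> {v}" by (intro component_least) auto
      then show ?thesis using affordable_singleton[OF v] by (intro exI[of _ "{v}"] exI[of _ 1]) auto
    qed
  qed
  then obtain D m where D: "affordable D m" "m \<le> 4" "?K \<subseteq> D \<union> E `` D" by blast
  then obtain ss where "completes (V - ?K) ss" "length ss \<le> ncols (V - ?K) + m"
    using completes_affordable[of D m "V - ?K"] by auto
  then show ?thesis using D(2) by (intro exI[of _ ss]) auto
qed

lemma solve_all_optimal:
  assumes "no_co_gem" "set vs = V"
  shows "optimal_on V (rev (solve_all vs vs {} []))"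
proof -
  have "optimal_on {} []" by (simp add: optimal_on_def)
  then show ?thesis
    using solve_all_correct[OF assms(2) few_extra_strokes[OF assms(1)], of vs "{}" "[]"] assms(2)
    by (simp add: edge_closed_def)
qed

end

section \<open>From backward completions to paint plans and library graphs\<close>

lemma apply_plan_snoc: "apply_plan (ss @ [s]) = apply_stroke s (apply_plan ss)"
  by (simp add: apply_plan_def)

context coloured_graph
begin

text \<open>The colour of a vertex is decided by the last stroke that covers it, which is the first
  one met when reading backwards; all later ones in \<open>rs\<close> find it a wildcard.\<close>

lemma completes_iff:
  assumes "\<forall>s \<in> set rs. conn (fst s)"
  shows "completes W rs \<longleftrightarrow> (\<forall>v \<in> V - W. apply_plan (rev rs) v = Some (t v))"
  using assms
proof (induction rs arbitrary: W)
  case Nil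
  then show ?case by (auto simp: apply_plan_def)
next
  case (Cons s rs)
  obtain A c where s: "s = (A, c)" by (cases s)
  have "A \<subseteq> V" using Cons.prems s by (auto simp: conn_def)
  then show ?case
    using Cons s by (auto simp: apply_plan_snoc)
qed

lemma apply_plan_None:
  assumes "\<forall>s \<in> set ss. conn (fst s)" "v \<notin> V"
  shows "apply_plan ss v = None"
  using assms(1)
proof (induction ss rule: rev_induct)
  case Nil
  then show ?case by (simp add: apply_plan_def)
next
  case (snoc s ss)
  obtain A c where s: "s = (A, c)" by (cases s)
  have "A \<subseteq> V" using snoc.prems s by (auto simp: conn_def)
  then show ?case using snoc s assms(2) by (auto simp: apply_plan_snoc)
qed

end

lemma rtrancl_on_iff: 
  assumes "a \<in> A" "r \<subseteq> A \<times> A"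
  shows "(a, b) \<in> rtrancl_on A r \<longleftrightarrow> (a, b) \<in> r\<^sup>*"
proof
  assume "(a, b) \<in> rtrancl_on A r"
  then show "(a, b) \<in> r\<^sup>*" by (rule rtrancl_on_rtranclI)
next
  assume "(a, b) \<in> r\<^sup>*"
  then show "(a, b) \<in> rtrancl_on A r"
    by induction (use assms in \<open>auto intro: rtrancl_on_into_rtrancl_on\<close>)
qed

lemma coloured_graph_of_pair_graph:
  assumes "pair_graph G"
  shows "coloured_graph (pverts G) (parcs G)"
proof -
  interpret pair_graph G by fact
  show ?thesis
  proof
    show "(v, v) \<notin> parcs G" for v using pair_no_loops[of "(v, v)"] by auto
  qed (use pair_finite_verts in_arcsD1 in_arcsD2 pair_sym_arcs in \<open>auto simp: symmetric_def\<close>)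
qed

lemma induce_subgraph_with_proj:
  "verts (induce_subgraph (with_proj G) A) = A"
  "arcs (induce_subgraph (with_proj G) A) = Restr (parcs G) A"
  "tail (induce_subgraph (with_proj G) A) = fst"
  "head (induce_subgraph (with_proj G) A) = snd"
  by (auto simp: induce_subgraph_def)

lemma wf_induce_subgraph_with_proj: "wf_digraph (induce_subgraph (with_proj G) A)"
  by unfold_locales (auto simp: induce_subgraph_with_proj)

lemma connected_set_iff:
  assumes "pair_graph G"
  shows "connected_set G A \<longleftrightarrow> coloured_graph.conn (pverts G) (parcs G) A"
proof -
  \<comment> \<open>Connectedness does not depend on the template, so any value serves.\<close>
  interpret coloured_graph "pverts G" "parcs G" undefined
    by (rule coloured_graph_of_pair_graph) fact
  let ?H = "mk_symmetric (induce_subgraph (with_proj G) A)"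
  \<comment> \<open>Library connectedness is strong connectedness of the symmetric closure, which
    changes nothing here because the arcs are already symmetric.\<close>
  have "parcs ?H = Restr (parcs G) A"
    using E_sym_iff by (auto simp: mk_symmetric_def induce_subgraph_with_proj)
  moreover have "pverts ?H = A" by (simp add: mk_symmetric_def induce_subgraph_with_proj)
  ultimately have "Digraph_Component.connected (induce_subgraph (with_proj G) A) \<longleftrightarrow>
      A \<noteq> {} \<and> (\<forall>u \<in> A. \<forall>v \<in> A. (u, v) \<in> rtrancl_on A (Restr (parcs G) A))"
    unfolding Digraph_Component.connected_def strongly_connected_def reachable_def by simp
  also have "\<dots> \<longleftrightarrow> A \<noteq> {} \<and> (\<forall>u \<in> A. \<forall>v \<in> A. (u, v) \<in> (Restr (parcs G) A)\<^sup>*)"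
    using rtrancl_on_iff[of _ A "Restr (parcs G) A"] by auto
  finally show ?thesis unfolding connected_set_def conn_def by auto
qed

text \<open>An undominated vertex \<open>x\<close> together with the path gives an explicit
  isomorphism onto \<open>co_gem\<close>: \<open>f\<close> numbers the path from 0 to 3 and sends
  \<open>x\<close> to 4.\<close>

lemma no_co_gem_if_co_gem_free:
  assumes "pair_graph G" "co_gem_free G"
  shows "coloured_graph.no_co_gem (pverts G) (parcs G)"
proof -
  interpret coloured_graph "pverts G" "parcs G" undefined
    by (rule coloured_graph_of_pair_graph) fact
  show ?thesis unfolding no_co_gem_def
  proof (intro allI impI, rule ccontr)
    fix a b c d assume P: "induced_P4 a b c d"
      and "\<not> pverts G \<subseteq> {a, b, c, d} \<union> parcs G `` {a, b, c, d}"
    then obtain x where x: "x \<in> pverts G" "x \<notin> {a, b, c, d}" "x \<notin> parcs G `` {a, b, c, d}"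
      by auto
    let ?A = "{a, b, c, d, x}"
    have AV: "?A \<subseteq> pverts G" using P x E_subset by (auto simp: induced_P4_def)
    have dist: "a \<noteq> b" "a \<noteq> c" "a \<noteq> d" "b \<noteq> c" "b \<noteq> d" "c \<noteq> d" "x \<noteq> a" "x \<noteq> b" "x \<noteq> c" "x \<noteq> d"
      using P x irrefl_E by (auto simp: induced_P4_def)
    define f :: "'a \<Rightarrow> nat" where
      "f v = (if v = a then 0 else if v = b then 1 else if v = c then 2 else if v = d then 3 else 4)"
      for v
    have f: "f a = 0" "f b = 1" "f c = 2" "f d = 3" "f x = 4" using dist by (auto simp: f_def)
    have edges: "Restr (parcs G) ?A = {(a, b), (b, a), (b, c), (c, b), (c, d), (d, c)}"
    proof -
      have "(a, b) \<in> parcs G" "(b, c) \<in> parcs G" "(c, d) \<in> parcs G" "(a, c) \<notin> parcs G"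
        "(a, d) \<notin> parcs G" "(b, d) \<notin> parcs G" "(a, x) \<notin> parcs G" "(b, x) \<notin> parcs G"
        "(c, x) \<notin> parcs G" "(d, x) \<notin> parcs G"
        using P x by (auto simp: induced_P4_def)
      moreover from this have "(b, a) \<in> parcs G" "(c, b) \<in> parcs G" "(d, c) \<in> parcs G"
        "(c, a) \<notin> parcs G" "(d, a) \<notin> parcs G" "(d, b) \<notin> parcs G" "(x, a) \<notin> parcs G"
        "(x, b) \<notin> parcs G" "(x, c) \<notin> parcs G" "(x, d) \<notin> parcs G"
        using E_sym_iff by blast+
      ultimately show ?thesis
        using irrefl_E by (intro equalityI subsetI; elim IntE SigmaE insertE emptyE; hypsubst) simp_all
    qed
    let ?H = "induce_subgraph (with_proj G) ?A"
    have H: "verts ?H = ?A" "arcs ?H = Restr (parcs G) ?A" "tail ?H = fst" "head ?H = snd"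
      by (rule induce_subgraph_with_proj)+
    have wfH: "wf_digraph ?H" by (rule wf_induce_subgraph_with_proj)
    let ?iso = "\<lparr>iso_verts = f, iso_arcs = map_prod f f, iso_head = snd, iso_tail = fst\<rparr>"
    have inj: "inj_on f ?A" using f by (auto simp: inj_on_def)
    have "inj_on (map_prod f f) (?A \<times> ?A)" by (rule map_prod_inj_on[OF inj inj])
    then have "inj_on (map_prod f f) (Restr (parcs G) ?A)"
      by (rule inj_on_subset) (rule Int_lower2)
    then have "pre_digraph.digraph_isomorphism ?H ?iso"
      unfolding pre_digraph.digraph_isomorphism_def H using wfH inj by (simp del: inj_on_insert)
    moreover have "app_iso ?iso ?H =
        \<lparr>verts = f ` ?A, arcs = map_prod f f ` Restr (parcs G) ?A, tail = fst, head = snd\<rparr>"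
      by (simp only: app_iso_def H digraph_isomorphism.simps)
    then have "with_proj co_gem = app_iso ?iso ?H"
      unfolding edges co_gem_def with_proj_def using f by simp
    ultimately have "digraph_iso ?H (with_proj co_gem)"
      unfolding digraph_iso_def by blast
    then show False using assms(2) AV unfolding co_gem_free_def by blast
  qed
qed

text \<open>A paint plan is a reversed completion from no wildcards with colours in
  \<open>C\<close>. Minimality among all completions is the stronger claim, since these may use any
  colours.\<close>

lemma optimal_paint_plan_rev:
  fixes G :: "'v pair_pre_digraph" and t :: "'v \<Rightarrow> 'c"
  assumes "pair_graph G" "t \<in> pverts G \<rightarrow> C" "pverts G \<noteq> {}"
    and opt: "coloured_graph.optimal_on (pverts G) (parcs G) t (pverts G) (rev ss)"
  shows "optimal_paint_plan G C t ss"
proof -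
  interpret coloured_graph "pverts G" "parcs G" t
    by (rule coloured_graph_of_pair_graph) fact
  have plan: "paint_plan G C t ss' \<longleftrightarrow> completes {} (rev ss') \<and> (\<forall>s \<in> set ss'. snd s \<in> C)" for ss'
  proof -
    have strokes: "(\<forall>s \<in> set ss'. is_stroke G C s) \<longleftrightarrow>
        (\<forall>s \<in> set ss'. conn (fst s)) \<and> (\<forall>s \<in> set ss'. snd s \<in> C)"
      using connected_set_iff[OF assms(1)] by (auto simp: is_stroke_def)
    show ?thesis
    proof (cases "\<forall>s \<in> set ss'. conn (fst s)")
      case True
      then have "completes {} (rev ss') \<longleftrightarrow> (\<forall>v \<in> pverts G. apply_plan ss' v = Some (t v))"
        using completes_iff[of "rev ss'" "{}"] by simp
      also have "\<dots> \<longleftrightarrow> apply_plan ss' = (\<lambda>v. if v \<in> pverts G then Some (t v) else None)"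
        using apply_plan_None[OF True] by (auto simp: fun_eq_iff)
      finally have c: "completes {} (rev ss') \<longleftrightarrow>
        apply_plan ss' = (\<lambda>v. if v \<in> pverts G then Some (t v) else None)" .
      \<comment> \<open>A non-empty vertex set forces at least one stroke, as the definition of a
        plan demands.\<close>
      moreover have "ss' \<noteq> []" if "completes {} (rev ss')" using that assms(3) by auto
      ultimately show ?thesis unfolding paint_plan_def strokes using True by auto
    next
      case False
      then show ?thesis unfolding paint_plan_def strokes using completes_conn[of "{}" "rev ss'"] by auto
    qed
  qed
  have "legal {} (rev ss) (pverts G)" and min: "\<And>ss'. completes {} ss' \<Longrightarrow> length ss \<le> length ss'"
    using opt unfolding optimal_on_def by auto
  then have "completes {} (rev ss)" "\<forall>s \<in> set ss. snd s \<in> C"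
    using legal_completes legal_stroke[of _ "rev ss"] assms(2) by fastforce+
  then show ?thesis unfolding optimal_paint_plan_def plan using min[of "rev _"] by auto
qed

section \<open>Cost-aware weakest preconditions\<close>

text \<open>Total correctness: the existence of an evaluation includes termination, and the
  postcondition also sees the number of steps.\<close>

definition wp :: "program \<Rightarrow> btree list \<Rightarrow> expr \<Rightarrow> (btree \<Rightarrow> nat \<Rightarrow> bool) \<Rightarrow> bool" where
  "wp P env e Q \<longleftrightarrow> (\<exists>v s. eval P env e v s \<and> Q v s)"

definition wps :: "program \<Rightarrow> btree list \<Rightarrow> expr list \<Rightarrow> (btree list \<Rightarrow> nat \<Rightarrow> bool) \<Rightarrow> bool" where
  "wps P env es Q \<longleftrightarrow> (\<exists>vs s. evals P env es vs s \<and> Q vs s)"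

text \<open>The evaluation rules become equivalences, so that rewriting with the \<open>wp\<close>
  laws executes a body symbolically.\<close>

lemma eval_EVar_iff: "eval P env (EVar i) v s \<longleftrightarrow> i < length env \<and> v = env ! i \<and> s = Suc 0"
  by (auto elim: eval_VarE intro: eval_Var[simplified])

lemma eval_ELeaf_iff: "eval P env ELeaf v s \<longleftrightarrow> v = Leaf \<and> s = Suc 0"
  by (auto elim: eval_LeafE intro: eval_Leaf[simplified])

lemma eval_ENode_iff:
  "eval P env (ENode e1 e2) v s \<longleftrightarrow> (\<exists>v1 s1 v2 s2. eval P env e1 v1 s1 \<and> eval P env e2 v2 s2 \<and>
     v = Node v1 v2 \<and> s = Suc (s1 + s2))"
  by (blast elim: eval_NodeE intro: eval_Node[simplified])

lemma eval_ECase_iff: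
  "eval P env (ECase e e1 e2) v s \<longleftrightarrow> (\<exists>u s1 s2. eval P env e u s1 \<and>
     (case u of Leaf \<Rightarrow> eval P env e1 v s2 | Node x y \<Rightarrow> eval P (x # y # env) e2 v s2) \<and>
     s = Suc (s1 + s2))"
    (is "?L \<longleftrightarrow> ?R")
proof
  assume ?L
  then show ?R
  proof (rule eval_CaseE)
    fix s1 s2
    assume "s = Suc (s1 + s2)" "eval P env e Leaf s1" "eval P env e1 v s2"
    then show ?R by (intro exI[of _ Leaf] exI[of _ s1] exI[of _ s2]) simp
  next
    fix x y s1 s2
    assume "s = Suc (s1 + s2)" "eval P env e (Node x y) s1" "eval P (x # y # env) e2 v s2"
    then show ?R by (intro exI[of _ "Node x y"] exI[of _ s1] exI[of _ s2]) simp
  qed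
next
  assume ?R
  then obtain u s1 s2 where "eval P env e u s1" "s = Suc (s1 + s2)"
    "case u of Leaf \<Rightarrow> eval P env e1 v s2 | Node x y \<Rightarrow> eval P (x # y # env) e2 v s2" by auto
  then show ?L
    by (cases u) (auto intro: eval_Case_Leaf[simplified] eval_Case_Node[simplified])
qed

lemma eval_ELet_iff:
  "eval P env (ELet e b) v s \<longleftrightarrow>
     (\<exists>x s1 s2. eval P env e x s1 \<and> eval P (x # env) b v s2 \<and> s = Suc (s1 + s2))"
  by (blast elim: eval_LetE intro: eval_Let[simplified])

lemma eval_ECall_iff:
  "eval P env (ECall f es) v s \<longleftrightarrow>
     f < length P \<and> (\<exists>vs s1 s2. evals P env es vs s1 \<and> eval P vs (P ! f) v s2 \<and> s = Suc (s1 + s2))"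
  by (blast elim: eval_CallE intro: eval_Call[simplified])

lemma evals_Nil_iff: "evals P env [] vs s \<longleftrightarrow> vs = [] \<and> s = 0"
  by (blast elim: evals_NilE intro: evals_Nil)

lemma evals_Cons_iff:
  "evals P env (e # es) vs s \<longleftrightarrow> (\<exists>v s1 vs' s2. eval P env e v s1 \<and> evals P env es vs' s2 \<and>
     vs = v # vs' \<and> s = s1 + s2)"
  by (blast elim: evals_ConsE intro: evals_Cons)

lemma wp_EVar: "i < length env \<Longrightarrow> wp P env (EVar i) Q \<longleftrightarrow> Q (env ! i) (Suc 0)"
  by (simp add: wp_def eval_EVar_iff)

lemma wp_ELeaf: "wp P env ELeaf Q \<longleftrightarrow> Q Leaf (Suc 0)"
  by (simp add: wp_def eval_ELeaf_iff)

lemma wp_ENode: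
  "wp P env (ENode e1 e2) Q \<longleftrightarrow>
     wp P env e1 (\<lambda>v1 s1. wp P env e2 (\<lambda>v2 s2. Q (Node v1 v2) (Suc (s1 + s2))))"
  unfolding wp_def eval_ENode_iff by blast

lemma ex_rearrange:
  "(\<exists>v s. (\<exists>u s1 s2. E u s1 \<and> C u v s2 \<and> s = Suc (s1 + s2)) \<and> Q v s) \<longleftrightarrow>
   (\<exists>u s1. E u s1 \<and> (\<exists>v s2. C u v s2 \<and> Q v (Suc (s1 + s2))))"
  by blast

lemma wp_ECase:
  "wp P env (ECase e e1 e2) Q \<longleftrightarrow> wp P env e (\<lambda>u s. case u of
     Leaf \<Rightarrow> wp P env e1 (\<lambda>v s1. Q v (Suc (s + s1)))
   | Node x y \<Rightarrow> wp P (x # y # env) e2 (\<lambda>v s2. Q v (Suc (s + s2))))"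
    (is "_ \<longleftrightarrow> wp P env e ?K")
proof -
  have "?K u s1 \<longleftrightarrow> (\<exists>v s2. (case u of Leaf \<Rightarrow> eval P env e1 v s2
      | Node x y \<Rightarrow> eval P (x # y # env) e2 v s2) \<and> Q v (Suc (s1 + s2)))" for u s1
    by (cases u) (simp_all add: wp_def)
  then have "wp P env e ?K \<longleftrightarrow> (\<exists>u s1. eval P env e u s1 \<and> (\<exists>v s2. (case u of Leaf \<Rightarrow> eval P env e1 v s2
      | Node x y \<Rightarrow> eval P (x # y # env) e2 v s2) \<and> Q v (Suc (s1 + s2))))"
    by (simp only: wp_def[of P env e])
  also have "\<dots> \<longleftrightarrow> wp P env (ECase e e1 e2) Q"
    unfolding wp_def eval_ECase_iff by (rule ex_rearrange[symmetric])
  finally show ?thesis by (rule sym)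
qed

lemma wp_ELet:
  "wp P env (ELet e b) Q \<longleftrightarrow>
     wp P env e (\<lambda>x s. wp P (x # env) b (\<lambda>v s'. Q v (Suc (s + s'))))"
  unfolding wp_def eval_ELet_iff by blast

lemma wp_ECall:
  "f < length P \<Longrightarrow> wp P env (ECall f es) Q \<longleftrightarrow>
     wps P env es (\<lambda>vs s. wp P vs (P ! f) (\<lambda>v s'. Q v (Suc (s + s'))))"
  unfolding wp_def wps_def eval_ECall_iff by blast

lemma wps_Nil: "wps P env [] Q \<longleftrightarrow> Q [] 0"
  by (simp add: wps_def evals_Nil_iff)

lemma wps_Cons:
  "wps P env (e # es) Q \<longleftrightarrow>
     wp P env e (\<lambda>v s. wps P env es (\<lambda>vs s'. Q (v # vs) (s + s')))"
  unfolding wp_def wps_def evals_Cons_iff by blast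

text \<open>Relative to a list rather than to the whole vertex set, so that loops over bit lists can
  be verified by induction on that list.\<close>

definition enc_on :: "nat list \<Rightarrow> nat set \<Rightarrow> btree" where
  "enc_on us A = enc_list (map (\<lambda>u. enc_bool (u \<in> A)) us)"

lemma enc_list_simps [simp]:
  "enc_list [] = Leaf"
  "enc_list (x # xs) = Node x (enc_list xs)"
  by (simp_all add: enc_list_def)

lemma enc_nat_simps [simp]:
  "enc_nat 0 = Leaf"
  "enc_nat (Suc m) = Node Leaf (enc_nat m)"
  by (simp_all add: enc_nat_def)

lemma enc_bool_simps [simp]:
  "enc_bool False = Leaf"
  "enc_bool True = Node Leaf Leaf"
  by (simp_all add: enc_bool_def)

lemma case_enc_bool [simp]:
  "(case enc_bool b of Leaf \<Rightarrow> x | Node l r \<Rightarrow> f l r) = (if b then f Leaf Leaf else x)"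
  by (cases b) simp_all

lemma enc_on_simps [simp]:
  "enc_on [] A = Leaf"
  "enc_on (u # us) A = Node (enc_bool (u \<in> A)) (enc_on us A)"
  by (simp_all add: enc_on_def)

lemma enc_on_cong: "A \<inter> set us = B \<inter> set us \<Longrightarrow> enc_on us A = enc_on us B"
  unfolding enc_on_def by (intro arg_cong[where f = enc_list] map_cong arg_cong[where f = enc_bool]) auto

lemma enc_plan_simps [simp]:
  "enc_plan [] = Leaf"
  "enc_plan (s # ss) = Node (enc_stroke s) (enc_plan ss)"
  by (simp_all add: enc_plan_def)

section \<open>The program\<close>

text \<open>
  A vertex set is represented by its list of membership bits, and a vertex by the pair of its colour
  and its singleton set. The functions \<open>f_solve\<close>, \<open>f_search\<close> and \<open>f_deepen\<close> signal failure by
  \<^const>\<open>Leaf\<close>.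
\<close>

definition "f_main = (0 :: nat)"
definition "f_orand = (1 :: nat)"
definition "f_step = (2 :: nat)"
definition "f_iter = (3 :: nat)"
definition "f_eq = (4 :: nat)"
definition "f_col = (5 :: nat)"
definition "f_sub = (6 :: nat)"
definition "f_stroke = (7 :: nat)"
definition "f_find = (8 :: nat)"
definition "f_cons = (9 :: nat)"
definition "f_greedy = (10 :: nat)"
definition "f_solve = (11 :: nat)"
definition "f_search = (12 :: nat)"
definition "f_deepen = (13 :: nat)"
definition "f_idx = (14 :: nat)"
definition "f_not = (15 :: nat)"
definition "f_all = (16 :: nat)"
definition "f_zero = (17 :: nat)"
definition "f_push = (18 :: nat)"
definition "f_verts = (19 :: nat)"
definition "f_loop = (20 :: nat)"

abbreviation "ETrue \<equiv> ENode ELeaf ELeaf"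

definition b_main :: expr where
  "b_main = ELet (ECall f_verts [EVar 2])
     (ECall f_loop [EVar 0, EVar 0, EVar 1, EVar 3, ECall f_zero [EVar 1], ELeaf])"

text \<open>One lockstep pass for \<open>A \<union> (B \<inter> C)\<close>: with
  \<open>B = C\<close> it is a union, and with an adjacency row as \<open>B\<close> it adds the
  neighbours that lie in \<open>C\<close>.\<close>

definition b_orand :: expr where
  "b_orand = ECase (EVar 0) ELeaf (ECase (EVar 3) ELeaf (ECase (EVar 6) ELeaf
     (ENode (ECase (EVar 4) (ECase (EVar 2) ELeaf (EVar 2)) ETrue)
            (ECall f_orand [EVar 5, EVar 3, EVar 1]))))"

definition b_step :: expr where
  "b_step = ECase (EVar 0) (EVar 3) (ECase (EVar 3) (EVar 5)
     (ECall f_step [EVar 3, EVar 1, EVar 6,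
        ECase (EVar 0) (EVar 7) (ECall f_orand [EVar 9, EVar 4, EVar 8])]))"

text \<open>The first argument is a counter in the form of a list; callers pass the adjacency
  matrix, whose length is the number of vertices.\<close>

definition b_iter :: expr where
  "b_iter = ECase (EVar 0) (EVar 3)
     (ECall f_iter [EVar 1, EVar 3, EVar 4, ECall f_step [EVar 3, EVar 5, EVar 4, EVar 5]])"

definition b_eq :: expr where
  "b_eq = ECase (EVar 0) (ECase (EVar 1) ETrue ELeaf)
     (ECase (EVar 3) ELeaf (ECall f_eq [EVar 3, EVar 1]))"

definition b_col :: expr where
  "b_col = ECase (EVar 0) ELeaf
     (ENode (ECall f_eq [EVar 0, EVar 3]) (ECall f_col [EVar 1, EVar 3]))"

definition b_sub :: expr where
  "b_sub = ECase (EVar 0) ETrue (ECase (EVar 3) ETrue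
     (ECase (EVar 2) (ECall f_sub [EVar 3, EVar 1])
        (ECase (EVar 2) ELeaf (ECall f_sub [EVar 7, EVar 5]))))"

definition b_stroke :: expr where
  "b_stroke = ELet (ECall f_col [EVar 1, EVar 3])
     (ECall f_iter [EVar 1, EVar 1, ECall f_orand [EVar 3, EVar 0, EVar 0], EVar 5])"

definition b_find :: expr where
  "b_find = ECase (EVar 0) ELeaf (ECase (EVar 0) ELeaf
     (ECase (ECall f_sub [EVar 1, EVar 7])
        (ELet (ECall f_stroke [EVar 5, EVar 6, EVar 7, EVar 0, EVar 1])
           (ECase (ECall f_sub [ECall f_col [EVar 7, EVar 1],
                                ECall f_orand [EVar 8, EVar 0, EVar 0]])
              (ECall f_find [EVar 4, EVar 6, EVar 7, EVar 8])
              (ENode (EVar 2) (EVar 3))))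
        (ECall f_find [EVar 5, EVar 7, EVar 8, EVar 9])))"

definition b_cons :: expr where
  "b_cons = ENode (ENode (ECall f_idx [EVar 0, ELeaf]) (EVar 1)) (EVar 2)"

definition b_greedy :: expr where
  "b_greedy = ECase (EVar 0) (ENode (EVar 4) (EVar 5))
     (ECase (ECall f_find [EVar 3, EVar 4, EVar 5, EVar 6])
        (ENode (EVar 6) (EVar 7))
        (ECall f_greedy [EVar 3, EVar 5, EVar 6, EVar 7,
           ECall f_orand [EVar 8, EVar 0, EVar 0], ECall f_cons [EVar 0, EVar 1, EVar 9]]))"

definition b_solve :: expr where
  "b_solve = ECase (ECall f_greedy [EVar 1, EVar 1, EVar 2, EVar 3, EVar 4, EVar 5]) ELeaf
     (ECase (ECall f_all [EVar 0])
        (ECase (EVar 2) ELeaf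
           (ECall f_search [EVar 5, EVar 1, EVar 5, EVar 6, EVar 7, EVar 2, EVar 3]))
        (ENode ELeaf (EVar 3)))"

definition b_search :: expr where
  "b_search = ECase (EVar 0) ELeaf (ECase (EVar 0) ELeaf
     (ECase (ECall f_sub [EVar 1, EVar 9])
        (ELet (ECall f_stroke [EVar 7, EVar 8, EVar 9, EVar 0, EVar 1])
           (ELet (ECall f_solve [EVar 6, EVar 7, EVar 8, EVar 9,
                    ECall f_orand [EVar 10, EVar 0, EVar 0],
                    ECall f_cons [EVar 0, EVar 1, EVar 11]])
              (ECase (EVar 0)
                 (ECall f_search [EVar 5, EVar 7, EVar 8, EVar 9, EVar 10, EVar 11, EVar 12])
                 (EVar 2))))
        (ECall f_search [EVar 5, EVar 7, EVar 8, EVar 9, EVar 10, EVar 11, EVar 12])))"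

definition b_deepen :: expr where
  "b_deepen = ECase (EVar 0) ELeaf
     (ELet (ECall f_solve [EVar 0, EVar 3, EVar 4, EVar 5, EVar 6, EVar 7])
        (ECase (EVar 0)
           (ECall f_deepen [EVar 2, EVar 4, EVar 5, EVar 6, EVar 7, EVar 8])
           (EVar 2)))"

definition b_idx :: expr where
  "b_idx = ECase (EVar 0) ELeaf
     (ELet (ECall f_idx [EVar 1, ENode ELeaf (EVar 3)])
        (ECase (EVar 1) (EVar 0) (ENode (EVar 6) (EVar 2))))"

definition b_not :: expr where
  "b_not = ECase (EVar 0) ELeaf (ENode (ECase (EVar 0) ETrue ELeaf) (ECall f_not [EVar 1]))"

definition b_all :: expr where
  "b_all = ECase (EVar 0) ETrue (ECase (EVar 0) ELeaf (ECall f_all [EVar 3]))"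

definition b_zero :: expr where
  "b_zero = ECase (EVar 0) ELeaf (ENode ELeaf (ECall f_zero [EVar 1]))"

definition b_push :: expr where
  "b_push = ECase (EVar 0) ELeaf (ECase (EVar 0) ELeaf
     (ENode (ENode (EVar 0) (ENode ELeaf (EVar 1))) (ECall f_push [EVar 3])))"

text \<open>Singletons are built recursively: the head gets a one bit followed by zeros, and those
  of the tail are extended by a leading zero.\<close>

definition b_verts :: expr where
  "b_verts = ECase (EVar 0) ELeaf
     (ENode (ENode (EVar 0) (ENode ETrue (ECall f_zero [EVar 1])))
            (ECall f_push [ECall f_verts [EVar 1]]))"

text \<open>The only literal of the language is the leaf, so a constant tree is rebuilt node by node
  at run time; \<open>qcost\<close> counts these steps.\<close>

primrec quote :: "btree \<Rightarrow> expr" where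
  "quote Leaf = ELeaf"
| "quote (Node l r) = ENode (quote l) (quote r)"

definition b_loop :: expr where
  "b_loop = ECase (EVar 0) (EVar 5) (ECase (EVar 0) ELeaf
     (ECase (ECall f_sub [EVar 1, EVar 8])
        (ELet (ECall f_iter [EVar 6, EVar 6, ECall f_not [ECall f_zero [EVar 6]], EVar 1])
           (ECase (ECall f_deepen [quote (enc_list (map enc_nat [0..<5])),
                     EVar 6, EVar 7, EVar 8, ECall f_not [EVar 0], EVar 10])
              ELeaf
              (ECall f_loop [EVar 6, EVar 8, EVar 9, EVar 10,
                 ECall f_orand [EVar 11, EVar 2, EVar 2], EVar 1])))
        (ECall f_loop [EVar 5, EVar 7, EVar 8, EVar 9, EVar 10, EVar 11])))"

definition painter :: program where
  "painter = [b_main, b_orand, b_step, b_iter, b_eq, b_col, b_sub, b_stroke, b_find, b_cons,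
     b_greedy, b_solve, b_search, b_deepen, b_idx, b_not, b_all, b_zero, b_push, b_verts, b_loop]"

lemmas f_defs = f_main_def f_orand_def f_step_def f_iter_def f_eq_def f_col_def f_sub_def
  f_stroke_def f_find_def f_cons_def f_greedy_def f_solve_def f_search_def f_deepen_def f_idx_def
  f_not_def f_all_def f_zero_def f_push_def f_verts_def f_loop_def

lemma painter_nth:
  "painter ! f_main = b_main" "painter ! f_orand = b_orand" "painter ! f_step = b_step"
  "painter ! f_iter = b_iter" "painter ! f_eq = b_eq" "painter ! f_col = b_col"
  "painter ! f_sub = b_sub" "painter ! f_stroke = b_stroke" "painter ! f_find = b_find"
  "painter ! f_cons = b_cons" "painter ! f_greedy = b_greedy" "painter ! f_solve = b_solve"
  "painter ! f_search = b_search" "painter ! f_deepen = b_deepen" "painter ! f_idx = b_idx"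
  "painter ! f_not = b_not" "painter ! f_all = b_all" "painter ! f_zero = b_zero"
  "painter ! f_push = b_push" "painter ! f_verts = b_verts" "painter ! f_loop = b_loop"
  by (simp_all add: painter_def f_defs)

lemma f_less:
  "f_main < length painter" "f_orand < length painter" "f_step < length painter"
  "f_iter < length painter" "f_eq < length painter" "f_col < length painter"
  "f_sub < length painter" "f_stroke < length painter" "f_find < length painter"
  "f_cons < length painter" "f_greedy < length painter" "f_solve < length painter"
  "f_search < length painter" "f_deepen < length painter" "f_idx < length painter"
  "f_not < length painter" "f_all < length painter" "f_zero < length painter"
  "f_push < length painter" "f_verts < length painter" "f_loop < length painter"
  by (simp_all add: painter_def f_defs)

lemmas wp_simps = wp_EVar wp_ELeaf wp_ENode wp_ECase wp_ELet wp_ECall wps_Nil wps_Cons f_less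

text \<open>The value is exact while the cost is an upper bound; \<open>wp_call\<close> then uses a
  callee without unfolding its body.\<close>

definition spec :: "nat \<Rightarrow> btree list \<Rightarrow> btree \<Rightarrow> nat \<Rightarrow> bool" where
  "spec f args v T \<longleftrightarrow> wp painter args (painter ! f) (\<lambda>v' s. v' = v \<and> s \<le> T)"

lemma wp_call:
  "spec f args v T \<Longrightarrow> (\<And>s. s \<le> T \<Longrightarrow> Q v s) \<Longrightarrow> wp painter args (painter ! f) Q"
  unfolding spec_def wp_def by blast

lemma spec_mono: "spec f args v T \<Longrightarrow> T \<le> T' \<Longrightarrow> spec f args v T'"
  unfolding spec_def wp_def by (meson order_trans)

fun qcost :: "btree \<Rightarrow> nat" where
  "qcost Leaf = 1"
| "qcost (Node l r) = 1 + qcost l + qcost r"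

lemma wp_quote: "wp P env (quote x) Q \<longleftrightarrow> Q x (qcost x)"
  by (induction x arbitrary: Q) (simp_all add: wp_simps)


section \<open>Correctness and cost of the list operations\<close>

lemma spec_orand:
  "spec f_orand [enc_on us A, enc_on us B, enc_on us C] (enc_on us (A \<union> (B \<inter> C)))
     (50 * (length us + 1))"
proof (induction us)
  case Nil
  show ?case unfolding spec_def painter_nth b_orand_def by (simp add: wp_simps)
next
  case (Cons u us)
  show ?case unfolding spec_def painter_nth(2) b_orand_def
    by (cases "u \<in> A"; cases "u \<in> B"; cases "u \<in> C"; simp add: wp_simps; rule wp_call[OF Cons.IH]; simp)
qed


lemma spec_cong: "spec f args v T \<Longrightarrow> v = v' \<Longrightarrow> T \<le> T' \<Longrightarrow> spec f args v' T'"
  using spec_mono by blast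

text \<open>The recursion stops when either numeral runs out, so the first one alone bounds the
  cost.\<close>

lemma spec_eq: "spec f_eq [enc_nat a, enc_nat b] (enc_bool (a = b)) (50 * (a + 1))"
proof (induction a arbitrary: b)
  case 0
  show ?case unfolding spec_def painter_nth(5) b_eq_def by (cases b) (simp_all add: wp_simps)
next
  case (Suc a)
  show ?case
  proof (cases b)
    case 0
    then show ?thesis unfolding spec_def painter_nth(5) b_eq_def by (simp add: wp_simps)
  next
    case b: (Suc b')
    show ?thesis unfolding spec_def painter_nth(5) b_eq_def b
      by (simp add: wp_simps, rule wp_call[OF Suc.IH], simp)
  qed
qed

lemma spec_sub:
  "spec f_sub [enc_on us A, enc_on us B] (enc_bool (A \<inter> set us \<subseteq> B)) (50 * (length us + 1))"
proof (induction us)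
  case Nil
  show ?case unfolding spec_def painter_nth b_sub_def by (simp add: wp_simps)
next
  case (Cons u us)
  show ?case
  proof (cases "u \<in> A \<and> u \<notin> B")
    case True
    then have "\<not> A \<inter> set (u # us) \<subseteq> B" by auto
    with True show ?thesis unfolding spec_def painter_nth b_sub_def by (simp add: wp_simps)
  next
    case False
    then have "A \<inter> set (u # us) \<subseteq> B \<longleftrightarrow> A \<inter> set us \<subseteq> B" by auto
    then have *: "enc_bool (A \<inter> set (u # us) \<subseteq> B) = enc_bool (A \<inter> set us \<subseteq> B)" by simp
    show ?thesis unfolding spec_def painter_nth(7) b_sub_def *
      using False
      by (cases "u \<in> A"; cases "u \<in> B"; simp add: wp_simps; intro wp_call[OF Cons.IH]; simp)
  qed
qed

lemma spec_not: "set us \<subseteq> X \<Longrightarrow> spec f_not [enc_on us A] (enc_on us (X - A)) (50 * (length us + 1))"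
proof (induction us)
  case Nil
  show ?case unfolding spec_def painter_nth b_not_def by (simp add: wp_simps)
next
  case (Cons u us)
  then have IH: "spec f_not [enc_on us A] (enc_on us (X - A)) (50 * (length us + 1))"
    and u: "u \<in> X" by auto
  show ?case unfolding spec_def painter_nth(16) b_not_def
    by (cases "u \<in> A"; simp add: wp_simps u; rule wp_call[OF IH]; simp)
qed

lemma spec_all: "spec f_all [enc_on us A] (enc_bool (set us \<subseteq> A)) (50 * (length us + 1))"
proof (induction us)
  case Nil
  show ?case unfolding spec_def painter_nth b_all_def by (simp add: wp_simps)
next
  case (Cons u us)
  show ?case unfolding spec_def painter_nth(17) b_all_def
    by (cases "u \<in> A"; simp add: wp_simps; rule wp_call[OF Cons.IH]; simp)
qed

lemma spec_zero:
  "spec f_zero [enc_list xs] (enc_list (replicate (length xs) Leaf)) (50 * (length xs + 1))"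
proof (induction xs)
  case Nil
  show ?case unfolding spec_def painter_nth b_zero_def by (simp add: wp_simps)
next
  case (Cons x xs)
  show ?case unfolding spec_def painter_nth(18) b_zero_def
    by (simp add: wp_simps; rule wp_call[OF Cons.IH]; simp)
qed

lemma spec_push:
  "spec f_push [enc_list (map (\<lambda>x. Node (f x) (g x)) xs)]
     (enc_list (map (\<lambda>x. Node (f x) (Node Leaf (g x))) xs)) (50 * (length xs + 1))"
proof (induction xs)
  case Nil
  show ?case unfolding spec_def painter_nth b_push_def by (simp add: wp_simps)
next
  case (Cons x xs)
  show ?case unfolding spec_def painter_nth(19) b_push_def
    by (simp add: wp_simps; rule wp_call[OF Cons.IH]; simp)
qed

lemma enc_on_empty: "enc_on us {} = enc_list (replicate (length us) Leaf)"
  by (induction us) simp_all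

lemma enc_on_map_Suc: "enc_on (map Suc us) A = enc_on us {i. Suc i \<in> A}"
  by (induction us) simp_all

lemma upt_0_Suc: "[0..<Suc m] = 0 # map Suc [0..<m]"
  by (simp add: upt_conv_Cons map_Suc_upt del: upt_Suc)

lemma spec_verts:
  "spec f_verts [enc_list (map enc_nat cs)]
     (enc_list (map (\<lambda>i. Node (enc_nat (cs ! i)) (enc_on [0..<length cs] {i})) [0..<length cs]))
     ((length cs + 1) * (100 * (length cs + 1) + 50))"
proof (induction cs)
  case Nil
  show ?case unfolding spec_def painter_nth b_verts_def by (simp add: wp_simps)
next
  case (Cons c cs)
  let ?m = "length cs"
  let ?vs = "map (\<lambda>i. Node (enc_nat (cs ! i)) (enc_on [0..<?m] {i})) [0..<?m]"
  let ?ws = "map (\<lambda>i. Node (enc_nat (cs ! i)) (Node Leaf (enc_on [0..<?m] {i}))) [0..<?m]"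
  have res: "map (\<lambda>i. Node (enc_nat ((c # cs) ! i)) (enc_on [0..<length (c # cs)] {i}))
      [0..<length (c # cs)] =
    Node (enc_nat c) (Node (Node Leaf Leaf) (enc_list (replicate ?m Leaf))) # ?ws"
    by (simp del: upt_Suc add: upt_0_Suc enc_on_map_Suc enc_on_empty)
  have z: "spec f_zero [enc_list (map enc_nat cs)] (enc_list (replicate ?m Leaf)) (50 * (?m + 1))"
    using spec_zero[of "map enc_nat cs"] by simp
  have p: "spec f_push [enc_list ?vs] (enc_list ?ws) (50 * (?m + 1))"
    using spec_push[of "\<lambda>i. enc_nat (cs ! i)" "\<lambda>i. enc_on [0..<?m] {i}" "[0..<?m]"] by simp
  \<comment> \<open>The increment pays for one pass of \<open>f_zero\<close> and one of
    \<open>f_push\<close>, both linear; this makes the bound quadratic.\<close>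
  have "(?m + 1) * (100 * (?m + 1) + 50) + 100 * (?m + 1) + 50 \<le>
      (length (c # cs) + 1) * (100 * (length (c # cs) + 1) + 50)"
    by (simp add: algebra_simps)
  then show ?case unfolding spec_def painter_nth(20) b_verts_def res
    by (simp del: upt_Suc add: wp_simps, intro wp_call[OF z], simp del: upt_Suc add: wp_simps,
      intro wp_call[OF Cons.IH], simp del: upt_Suc add: wp_simps, intro wp_call[OF p], simp)
qed

text \<open>The start \<open>i\<close> is arbitrary because the recursion increments the position
  counter.\<close>

lemma spec_idx:
  "spec f_idx [enc_on [i..<i + m] S, enc_nat i]
     (enc_list (map enc_nat (filter (\<lambda>x. x \<in> S) [i..<i + m]))) (50 * (m + 1))"
proof (induction m arbitrary: i)
  case 0
  show ?case unfolding spec_def painter_nth b_idx_def by (simp add: wp_simps)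
next
  case (Suc m)
  define us where "us = [Suc i..<Suc i + m]"
  have u: "[i..<i + Suc m] = i # us" by (simp add: us_def upt_conv_Cons del: upt_Suc)
  have IH: "spec f_idx [enc_on us S, Node Leaf (enc_nat i)]
     (enc_list (map enc_nat (filter (\<lambda>x. x \<in> S) us))) (50 * (m + 1))"
    using Suc.IH[of "Suc i"] by (simp add: us_def)
  show ?case unfolding spec_def painter_nth(15) b_idx_def u
    by (cases "i \<in> S"; simp add: wp_simps; rule wp_call[OF IH]; simp add: wp_simps)
qed

section \<open>Running time\<close>

text \<open>The numeric constants are chosen generously; only polynomial growth matters.\<close>

definition t_row :: "nat \<Rightarrow> nat" where
  "t_row N = 50 * (N + 1)"

definition t_step :: "nat \<Rightarrow> nat" where
  "t_step N = (N + 1) * (t_row N + 50)"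

definition t_iter :: "nat \<Rightarrow> nat" where
  "t_iter N = (N + 1) * (t_step N + 50)"

definition t_stroke :: "nat \<Rightarrow> nat" where
  "t_stroke N = t_iter N + t_step N + t_row N + 50"

definition t_find :: "nat \<Rightarrow> nat" where
  "t_find N = (N + 1) * (t_stroke N + t_step N + 3 * t_row N + 100)"

definition t_greedy :: "nat \<Rightarrow> nat" where
  "t_greedy N = (N + 1) * (t_find N + 2 * t_row N + 150)"

text \<open>Each unit of budget contributes another factor of order \<open>N\<close>, so the bound
  is polynomial only because the budget is a constant.\<close>

primrec t_solve :: "nat \<Rightarrow> nat \<Rightarrow> nat" where
  "t_solve N 0 = t_greedy N + t_row N + 50"
| "t_solve N (Suc d) =
     t_greedy N + t_row N + 50 + (N + 1) * (t_solve N d + t_stroke N + 4 * t_row N + 200)"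

text \<open>Five budgets and the end of the list make six rounds, each bounded by the cost of the
  largest budget.\<close>

definition t_deepen :: "nat \<Rightarrow> nat" where
  "t_deepen N = 6 * (t_solve N 4 + 50)"

definition t_loop :: "nat \<Rightarrow> nat" where
  "t_loop N = (N + 1) * (t_iter N + t_deepen N + 5 * t_row N + 300)"

definition t_verts :: "nat \<Rightarrow> nat" where
  "t_verts N = (N + 1) * (100 * (N + 1) + 50)"

definition t_main :: "nat \<Rightarrow> nat" where
  "t_main N = t_verts N + t_loop N + t_row N + 50"

lemma t_solve_mono:
  assumes "d \<le> d'"
  shows "t_solve N d \<le> t_solve N d'"
proof -
  have "t_solve N d \<le> t_solve N (Suc d)" for d
    by (induction d) auto
  then show ?thesis using assms by (rule lift_Suc_mono_le)
qed

text \<open>The extra node is a tag: the empty plan is itself encoded as \<open>Leaf\<close>, which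
  here signals failure.\<close>

primrec enc_result :: "(nat, nat) stroke list option \<Rightarrow> btree" where
  "enc_result None = Leaf"
| "enc_result (Some ss) = Node Leaf (enc_plan ss)"

text \<open>\<open>N\<close> bounds the number of vertices as well as every colour numeral, so all
  running times are functions of one variable.\<close>

locale encoded_graph = coloured_graph V E t for V :: "nat set" and E and t :: "nat \<Rightarrow> nat" +
  fixes n N :: nat
  assumes V_eq: "V = {..<n}" and n_le: "n \<le> N" and t_le: "v \<in> V \<Longrightarrow> t v \<le> N"
begin

section \<open>Execution on an encoded graph\<close>

definition ids :: "nat list" where
  "ids = [0..<n]"

abbreviation eset :: "nat set \<Rightarrow> btree" where
  "eset A \<equiv> enc_on ids A"

definition enc_rows :: "nat list \<Rightarrow> btree" where
  "enc_rows us = enc_list (map (\<lambda>u. eset (E `` {u})) us)"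

definition enc_cols :: "nat list \<Rightarrow> btree" where
  "enc_cols us = enc_list (map (\<lambda>u. enc_nat (t u)) us)"

definition enc_verts :: "nat list \<Rightarrow> btree" where
  "enc_verts us = enc_list (map (\<lambda>u. Node (enc_nat (t u)) (eset {u})) us)"

lemma enc_simps [simp]:
  "enc_rows [] = Leaf" "enc_cols [] = Leaf" "enc_verts [] = Leaf"
  "enc_rows (u # us) = Node (eset (E `` {u})) (enc_rows us)"
  "enc_cols (u # us) = Node (enc_nat (t u)) (enc_cols us)"
  "enc_verts (u # us) = Node (Node (enc_nat (t u)) (eset {u})) (enc_verts us)"
  by (simp_all add: enc_rows_def enc_cols_def enc_verts_def)

lemma set_ids [simp]: "set ids = V"
  by (auto simp: ids_def V_eq)

lemma length_ids [simp]: "length ids = n"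
  by (simp add: ids_def)

lemma row_le: "50 * (n + 1) \<le> t_row N"
  using n_le by (simp add: t_row_def)

lemma spec_union: "spec f_orand [eset A, eset B, eset B] (eset (A \<union> B)) (t_row N)"
  by (rule spec_cong[OF spec_orand]) (use row_le in auto)

lemma spec_absorb: "spec f_orand [eset A, eset B, eset C] (eset (A \<union> B \<inter> C)) (t_row N)"
  by (rule spec_cong[OF spec_orand]) (use row_le in auto)

lemma spec_mem: "u \<in> V \<Longrightarrow> spec f_sub [eset {u}, eset A] (enc_bool (u \<in> A)) (t_row N)"
  by (rule spec_cong[OF spec_sub]) (use row_le in auto)

lemma spec_subset: "A \<subseteq> V \<Longrightarrow> spec f_sub [eset A, eset B] (enc_bool (A \<subseteq> B)) (t_row N)"
  by (rule spec_cong[OF spec_sub]) (use row_le in \<open>auto simp: Int_absorb2\<close>)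

lemma spec_complement: "spec f_not [eset A] (eset (V - A)) (t_row N)"
  by (rule spec_cong[OF spec_not[where X = V]]) (use row_le in auto)

lemma spec_full: "spec f_all [eset A] (enc_bool (V \<subseteq> A)) (t_row N)"
  by (rule spec_cong[OF spec_all]) (use row_le in auto)

lemma spec_empty: "spec f_zero [enc_rows ids] (eset {}) (t_row N)"
  unfolding enc_rows_def by (rule spec_cong[OF spec_zero]) (use row_le in \<open>auto simp: enc_on_empty\<close>)

lemma spec_step:
  "spec f_step [enc_rows us, enc_on us S, eset W, eset A] (eset (A \<union> (E `` (S \<inter> set us) \<inter> W)))
     ((length us + 1) * (t_row N + 50))"
proof (induction us arbitrary: A)
  case Nil
  show ?case unfolding spec_def painter_nth b_step_def by (simp add: wp_simps)
next
  case (Cons u us)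
  let ?R = "eset (A \<union> (E `` (S \<inter> set (u # us)) \<inter> W))"
  show ?case
  proof (cases "u \<in> S")
    case True
    have IH: "spec f_step [enc_rows us, enc_on us S, eset W, eset (A \<union> E `` {u} \<inter> W)] ?R
        ((length us + 1) * (t_row N + 50))"
      by (rule spec_cong[OF Cons.IH]) (use True in \<open>auto intro!: enc_on_cong\<close>)
    show ?thesis unfolding spec_def painter_nth(3) b_step_def
      by (simp only: enc_simps enc_on_simps True enc_bool_simps; simp add: wp_simps;
        rule wp_call[OF spec_absorb]; rule wp_call[OF IH]; simp)
  next
    case False
    have IH: "spec f_step [enc_rows us, enc_on us S, eset W, eset A] ?R
        ((length us + 1) * (t_row N + 50))"
      by (rule spec_cong[OF Cons.IH]) (use False in \<open>auto intro!: enc_on_cong\<close>)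
    show ?thesis unfolding spec_def painter_nth(3) b_step_def
      by (simp only: enc_simps enc_on_simps False enc_bool_simps; simp add: wp_simps;
        rule wp_call[OF IH]; simp)
  qed
qed

definition grow :: "nat set \<Rightarrow> nat set \<Rightarrow> nat set" where
  "grow W S = S \<union> (E `` S \<inter> W)"

lemma spec_iter:
  assumes "S \<subseteq> V"
  shows "spec f_iter [enc_list xs, enc_rows ids, eset W, eset S]
     (eset ((grow W ^^ length xs) S)) ((length xs + 1) * (t_step N + 50))"
  using assms
proof (induction xs arbitrary: S)
  case Nil
  show ?case unfolding spec_def painter_nth b_iter_def by (simp add: wp_simps)
next
  case (Cons x xs)
  have g: "grow W S \<subseteq> V" using Cons.prems E_subset by (auto simp: grow_def)
  have "(length ids + 1) * (t_row N + 50) \<le> t_step N"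
    unfolding t_step_def using n_le by (intro mult_le_mono) auto
  then have st: "spec f_step [enc_rows ids, eset S, eset W, eset S] (eset (grow W S)) (t_step N)"
    using Cons.prems by (intro spec_cong[OF spec_step]) (auto simp: grow_def Int_absorb2)
  have IH: "spec f_iter [enc_list xs, enc_rows ids, eset W, eset (grow W S)]
     (eset ((grow W ^^ length (x # xs)) S)) ((length xs + 1) * (t_step N + 50))"
    by (rule spec_cong[OF Cons.IH[OF g]]) (simp_all add: funpow_swap1)
  show ?case unfolding spec_def painter_nth(4) b_iter_def
    by (simp add: wp_simps del: funpow.simps; rule wp_call[OF st]; rule wp_call[OF IH];
      simp del: funpow.simps)
qed

text \<open>The iterates increase within an \<open>n\<close>-element set, so they are stationary
  after \<open>n\<close> rounds; a stationary set is closed under adjacency in \<open>W\<close> and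
  contains the component.\<close>

lemma grow_iterate:
  assumes "v \<in> V" "v \<in> W"
  shows "(grow W ^^ n) {v} = component W v"
proof -
  let ?S = "\<lambda>k. (grow W ^^ k) {v}"
  have sub: "?S k \<subseteq> component W v" for k
  proof (induction k)
    case (Suc k)
    then show ?case using component_closed[of _ W v] assms(2) by (fastforce simp: grow_def)
  qed simp
  have SV: "?S k \<subseteq> V" for k
    by (induction k) (use assms(1) E_subset in \<open>auto simp: grow_def\<close>)
  \<comment> \<open>The chain starts with one element and gains one in each round until it stops.
    Strictness matters: at \<open>k = n\<close> the second alternative would need more than
    \<open>n\<close> vertices.\<close>
  have "?S (Suc k) = ?S k \<or> k < card (?S k)" for k
  proof (induction k)
    case 0
    then show ?case by simp
  next
    case (Suc k)
    show ?case
    proof (cases "?S (Suc (Suc k)) = ?S (Suc k)")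
      case False
      have step: "?S (Suc j) = grow W (?S j)" for j by simp
      have ne: "?S (Suc k) \<noteq> ?S k"
      proof
        assume "?S (Suc k) = ?S k"
        then have "grow W (?S (Suc k)) = grow W (?S k)" by (rule arg_cong)
        then show False using False unfolding step[symmetric] by blast
      qed
      moreover have "?S k \<subseteq> ?S (Suc k)" unfolding step by (auto simp: grow_def)
      moreover have "finite (?S (Suc k))" by (rule finite_subset[OF SV finite_V])
      ultimately have "card (?S k) < card (?S (Suc k))" by (intro psubset_card_mono psubsetI) metis+
      moreover have "k < card (?S k)" using Suc ne by blast
      ultimately show ?thesis by linarith
    qed blast
  qed
  moreover have "card (?S n) \<le> n"
    using card_mono[OF finite_V SV[of n]] by (simp add: V_eq)
  ultimately have fix_pt: "?S (Suc n) = ?S n" by (meson not_less)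
  have v: "v \<in> ?S k" for k by (induction k) (auto simp: grow_def)
  have "component W v \<subseteq> ?S n"
  proof (rule component_least)
    show "v \<in> ?S n" by (rule v)
  next
    fix u w assume "u \<in> ?S n" "(u, w) \<in> E" "w \<in> W"
    then have "w \<in> ?S (Suc n)" by (auto simp: grow_def)
    then show "w \<in> ?S n" using fix_pt by simp
  qed
  then show ?thesis using sub[of n] by auto
qed

lemma spec_component:
  assumes "v \<in> V" "v \<in> W"
  shows "spec f_iter [enc_rows ids, enc_rows ids, eset W, eset {v}]
     (eset (component W v)) (t_iter N)"
proof -
  have "(n + 1) * (t_step N + 50) \<le> t_iter N"
    unfolding t_iter_def using n_le by (intro mult_le_mono) auto
  then show ?thesis
    using spec_cong[OF spec_iter[of "{v}" "map (\<lambda>u. eset (E `` {u})) ids" W]] assms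
    by (simp add: grow_iterate flip: enc_rows_def)
qed

lemma spec_col_aux:
  assumes "set us \<subseteq> V"
  shows "spec f_col [enc_cols us, enc_nat c] (enc_on us {u \<in> V. t u = c})
     ((length us + 1) * (t_row N + 50))"
  using assms
proof (induction us)
  case Nil
  show ?case unfolding spec_def painter_nth b_col_def by (simp add: wp_simps)
next
  case (Cons u us)
  then have u: "u \<in> V" and IH: "spec f_col [enc_cols us, enc_nat c] (enc_on us {u \<in> V. t u = c})
     ((length us + 1) * (t_row N + 50))"
    by auto
  have "50 * (t u + 1) \<le> t_row N" using t_le[OF u] by (simp add: t_row_def)
  then have eq: "spec f_eq [enc_nat (t u), enc_nat c] (enc_bool (t u = c)) (t_row N)"
    by (rule spec_mono[OF spec_eq])
  show ?case unfolding spec_def painter_nth(6) b_col_def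
    by (simp add: wp_simps u, rule wp_call[OF eq], rule wp_call[OF IH], simp)
qed

lemma spec_col:
  "spec f_col [enc_cols ids, enc_nat c] (eset {u \<in> V. t u = c}) (t_step N)"
proof -
  have "(n + 1) * (t_row N + 50) \<le> t_step N"
    unfolding t_step_def using n_le by (intro mult_le_mono) auto
  then show ?thesis by (intro spec_cong[OF spec_col_aux]) auto
qed

lemma spec_stroke:
  assumes "v \<in> V"
  shows "spec f_stroke [enc_rows ids, enc_cols ids, eset W, enc_nat (t v), eset {v}]
     (eset (stroke W v)) (t_stroke N)"
proof -
  have c: "spec f_iter [enc_rows ids, enc_rows ids, eset (W \<union> {u \<in> V. t u = t v}), eset {v}]
     (eset (stroke W v)) (t_iter N)"
    unfolding stroke_def by (rule spec_component) (use assms in auto)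
  show ?thesis unfolding spec_def painter_nth(8) b_stroke_def
    by (simp add: wp_simps, rule wp_call[OF spec_col], (simp add: wp_simps)?,
      rule wp_call[OF spec_union], rule wp_call[OF c], simp add: t_stroke_def)
qed

lemma spec_find:
  assumes "set us \<subseteq> V"
  shows "spec f_find [enc_verts us, enc_rows ids, enc_cols ids, eset W]
     (case find (finishing W) us of
        None \<Rightarrow> Leaf | Some v \<Rightarrow> Node (eset (stroke W v)) (enc_nat (t v)))
     ((length us + 1) * (t_stroke N + t_step N + 3 * t_row N + 100))"
  using assms
proof (induction us)
  case Nil
  show ?case unfolding spec_def painter_nth b_find_def by (simp add: wp_simps)
next
  case (Cons u us)
  let ?r = "\<lambda>us. case find (finishing W) us of
        None \<Rightarrow> Leaf | Some v \<Rightarrow> Node (eset (stroke W v)) (enc_nat (t v))"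
  have u: "u \<in> V" and IH: "spec f_find [enc_verts us, enc_rows ids, enc_cols ids, eset W] (?r us)
      ((length us + 1) * (t_stroke N + t_step N + 3 * t_row N + 100))"
    using Cons by auto
  note mem = spec_mem[OF u, of W]
  have sub: "spec f_sub [eset {v \<in> V. t v = t u}, eset (W \<union> stroke W u)]
      (enc_bool ({v \<in> V. t v = t u} \<subseteq> W \<union> stroke W u)) (t_row N)"
    by (rule spec_subset) auto
  show ?case
  proof (cases "u \<in> W")
    case True
    then have r: "?r (u # us) = ?r us" by (simp add: finishing_def)
    show ?thesis unfolding spec_def painter_nth(9) b_find_def r
      by (simp add: wp_simps, rule wp_call[OF mem], (simp add: True wp_simps)?,
        rule wp_call[OF IH], simp)
  next
    case False
    show ?thesis
    proof (cases "{v \<in> V. t v = t u} \<subseteq> W \<union> stroke W u")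
      case fin: True
      then have r: "?r (u # us) = Node (eset (stroke W u)) (enc_nat (t u))"
        using False by (simp add: finishing_def)
      show ?thesis unfolding spec_def painter_nth(9) b_find_def r
        by (simp add: wp_simps, rule wp_call[OF mem], (simp add: False wp_simps)?,
          rule wp_call[OF spec_stroke[OF u]], (simp add: wp_simps)?, rule wp_call[OF spec_col],
          rule wp_call[OF spec_union], rule wp_call[OF sub], simp only: fin enc_bool_simps,
          simp add: wp_simps)
    next
      case fin: False
      then have r: "?r (u # us) = ?r us" by (simp add: finishing_def)
      show ?thesis unfolding spec_def painter_nth(9) b_find_def r
        by (simp add: wp_simps, rule wp_call[OF mem], (simp add: False wp_simps)?,
          rule wp_call[OF spec_stroke[OF u]], (simp add: wp_simps)?, rule wp_call[OF spec_col],
          rule wp_call[OF spec_union], rule wp_call[OF sub], simp only: fin enc_bool_simps,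
          simp add: wp_simps, rule wp_call[OF IH], simp)
    qed
  qed
qed

lemma spec_find_ids:
  "spec f_find [enc_verts ids, enc_rows ids, enc_cols ids, eset W]
     (case find (finishing W) ids of
        None \<Rightarrow> Leaf | Some v \<Rightarrow> Node (eset (stroke W v)) (enc_nat (t v))) (t_find N)"
proof (rule spec_mono[OF spec_find])
  show "(length ids + 1) * (t_stroke N + t_step N + 3 * t_row N + 100) \<le> t_find N"
    unfolding t_find_def using n_le by (intro mult_le_mono) auto
qed simp

text \<open>\<open>enc_stroke\<close> lists vertices in increasing order, the order in which
  \<open>f_idx\<close> meets the bits, so no sorting is required.\<close>

lemma spec_cons:
  assumes "S \<subseteq> V"
  shows "spec f_cons [eset S, enc_nat c, enc_plan acc] (enc_plan ((S, c) # acc)) (t_row N + 20)"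
proof -
  have "sorted_list_of_set (set (filter (\<lambda>x. x \<in> S) ids)) = filter (\<lambda>x. x \<in> S) ids"
    unfolding ids_def by (intro sorted_list_of_set.idem_if_sorted_distinct) (simp_all add: sorted_wrt_filter)
  moreover have "set (filter (\<lambda>x. x \<in> S) ids) = S" using assms by auto
  ultimately have S: "sorted_list_of_set S = filter (\<lambda>x. x \<in> S) ids" by simp
  have idx: "spec f_idx [eset S, Leaf] (enc_list (map enc_nat (sorted_list_of_set S))) (t_row N)"
    unfolding S using spec_mono[OF spec_idx[of 0 n S] row_le] by (simp add: ids_def)
  show ?thesis unfolding spec_def painter_nth b_cons_def
    by (simp add: wp_simps enc_stroke_def, rule wp_call[OF idx], simp)
qed

text \<open>\<open>xs\<close> is fuel of which only the length matters; the program passes the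
  vertex list.\<close>

lemma spec_greedy:
  assumes "W \<subseteq> V"
  shows "spec f_greedy
     [enc_list xs, enc_verts ids, enc_rows ids, enc_cols ids, eset W, enc_plan acc]
     (case greedy ids (length xs) W acc of (W', acc') \<Rightarrow> Node (eset W') (enc_plan acc'))
     ((length xs + 1) * (t_find N + 2 * t_row N + 150))"
  using assms
proof (induction xs arbitrary: W acc)
  case Nil
  show ?case unfolding spec_def painter_nth b_greedy_def by (simp add: wp_simps)
next
  case (Cons x xs)
  note f = spec_find_ids[of W]
  show ?case
  proof (cases "find (finishing W) ids")
    case None
    show ?thesis unfolding spec_def painter_nth(11) b_greedy_def
      by (simp add: wp_simps None, rule wp_call[OF f], (simp add: None wp_simps)?)
  next
    case (Some v)
    then have v: "v \<in> V" by (auto simp: find_Some_iff simp flip: set_ids)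
    then have S: "stroke W v \<subseteq> V" using stroke_subset_V Cons.prems by blast
    have IH: "spec f_greedy
     [enc_list xs, enc_verts ids, enc_rows ids, enc_cols ids, eset (W \<union> stroke W v),
      enc_plan ((stroke W v, t v) # acc)]
     (case greedy ids (length (x # xs)) W acc of (W', acc') \<Rightarrow> Node (eset W') (enc_plan acc'))
     ((length xs + 1) * (t_find N + 2 * t_row N + 150))"
      by (rule spec_cong[OF Cons.IH]) (use S Cons.prems Some in auto)
    show ?thesis unfolding spec_def painter_nth(11) b_greedy_def
      by (simp add: wp_simps del: greedy.simps, rule wp_call[OF f],
        (simp add: Some wp_simps del: greedy.simps)?,
        rule wp_call[OF spec_union], (simp add: wp_simps del: greedy.simps enc_plan_simps)?,
        rule wp_call[OF spec_cons[OF S]],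
        rule wp_call[OF IH], simp del: greedy.simps)
  qed
qed

lemma spec_greedy_ids:
  assumes "W \<subseteq> V"
  shows "spec f_greedy
     [enc_verts ids, enc_verts ids, enc_rows ids, enc_cols ids, eset W, enc_plan acc]
     (case greedy ids n W acc of (W', acc') \<Rightarrow> Node (eset W') (enc_plan acc')) (t_greedy N)"
proof -
  have "(n + 1) * (t_find N + 2 * t_row N + 150) \<le> t_greedy N"
    unfolding t_greedy_def using n_le by (intro mult_le_mono) auto
  then show ?thesis
    using spec_mono[OF spec_greedy[OF assms, of "map (\<lambda>u. Node (enc_nat (t u)) (eset {u})) ids" acc]]
    by (simp flip: enc_verts_def)
qed

end

context encoded_graph
begin

lemma greedy_subset:
  assumes "W \<subseteq> V" "greedy ids n W acc = (W', acc')"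
  shows "W' \<subseteq> V"
  using greedy_correct[OF set_ids assms(1) _ assms(2)] ncols_le_length_list[OF set_ids, of W] by auto

text \<open>\<open>f_search\<close> and \<open>f_solve\<close> call each other. Taking the
  specification of \<open>f_solve\<close> at budget \<open>d\<close> as a hypothesis breaks the
  cycle; the induction in \<open>spec_solve\<close> supplies it.\<close>

lemma spec_search:
  assumes solve: "\<And>W acc. W \<subseteq> V \<Longrightarrow>
      spec f_solve [enc_nat d, enc_verts ids, enc_rows ids, enc_cols ids, eset W, enc_plan acc]
        (enc_result (solve ids d W acc)) T"
    and W: "W \<subseteq> V" and "set us \<subseteq> V"
  shows "spec f_search
     [enc_verts us, enc_nat d, enc_verts ids, enc_rows ids, enc_cols ids, eset W, enc_plan acc]
     (enc_result (first_some (\<lambda>v. if v \<in> W then None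
        else solve ids d (W \<union> stroke W v) ((stroke W v, t v) # acc)) us))
     ((length us + 1) * (T + t_stroke N + 4 * t_row N + 200))"
  using assms(3)
proof (induction us)
  case Nil
  show ?case unfolding spec_def painter_nth b_search_def by (simp add: wp_simps)
next
  case (Cons u us)
  let ?f = "\<lambda>v. if v \<in> W then None
        else solve ids d (W \<union> stroke W v) ((stroke W v, t v) # acc)"
  have u: "u \<in> V" and IH: "spec f_search
     [enc_verts us, enc_nat d, enc_verts ids, enc_rows ids, enc_cols ids, eset W, enc_plan acc]
     (enc_result (first_some ?f us)) ((length us + 1) * (T + t_stroke N + 4 * t_row N + 200))"
    using Cons by auto
  have S: "stroke W u \<subseteq> V" using stroke_subset_V u W by blast
  note mem = spec_mem[OF u, of W]
  show ?case
  proof (cases "u \<in> W")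
    case True
    then have r: "first_some ?f (u # us) = first_some ?f us" by simp
    show ?thesis unfolding spec_def painter_nth(13) b_search_def r
      by (simp add: wp_simps, rule wp_call[OF mem], simp add: True wp_simps,
        rule wp_call[OF IH], simp)
  next
    case False
    let ?s = "solve ids d (W \<union> stroke W u) ((stroke W u, t u) # acc)"
    have sol: "spec f_solve [enc_nat d, enc_verts ids, enc_rows ids, enc_cols ids,
        eset (W \<union> stroke W u), enc_plan ((stroke W u, t u) # acc)] (enc_result ?s) T"
      by (intro solve Un_least W S)
    show ?thesis
    proof (cases ?s)
      case None
      then have r: "first_some ?f (u # us) = first_some ?f us" by simp
      show ?thesis unfolding spec_def painter_nth(13) b_search_def r
        by (simp add: wp_simps, rule wp_call[OF mem], simp add: False wp_simps,
          rule wp_call[OF spec_stroke[OF u]], (simp add: wp_simps)?,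
          rule wp_call[OF spec_union], rule wp_call[OF spec_cons[OF S]],
          rule wp_call[OF sol], simp add: None wp_simps, rule wp_call[OF IH], simp)
    next
      case (Some r)
      then have r: "first_some ?f (u # us) = Some r" using False by simp
      show ?thesis unfolding spec_def painter_nth(13) b_search_def r
        by (simp add: wp_simps, rule wp_call[OF mem], simp add: False wp_simps,
          rule wp_call[OF spec_stroke[OF u]], (simp add: wp_simps)?,
          rule wp_call[OF spec_union], rule wp_call[OF spec_cons[OF S]],
          rule wp_call[OF sol], simp add: Some wp_simps)
    qed
  qed
qed

lemma spec_solve:
  assumes "W \<subseteq> V"
  shows "spec f_solve [enc_nat d, enc_verts ids, enc_rows ids, enc_cols ids, eset W, enc_plan acc]
     (enc_result (solve ids d W acc)) (t_solve N d)"
  using assms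
proof (induction d arbitrary: W acc)
  case 0
  obtain W' acc' where g: "greedy ids n W acc = (W', acc')" by fastforce
  have gr: "spec f_greedy
     [enc_verts ids, enc_verts ids, enc_rows ids, enc_cols ids, eset W, enc_plan acc]
     (Node (eset W') (enc_plan acc')) (t_greedy N)"
    using spec_greedy_ids[OF 0] g by (metis case_prod_conv)
  show ?case
  proof (cases "V \<subseteq> W'")
    case True
    then have r: "solve ids 0 W acc = Some acc'" using g by simp
    show ?thesis unfolding spec_def painter_nth(12) b_solve_def r
      by (simp add: wp_simps, rule wp_call[OF gr], simp add: wp_simps,
        rule wp_call[OF spec_full], simp only: True enc_bool_simps, simp add: wp_simps)
  next
    case False
    then have r: "solve ids 0 W acc = None" using g by simp
    show ?thesis unfolding spec_def painter_nth(12) b_solve_def r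
      by (simp add: wp_simps, rule wp_call[OF gr], simp add: wp_simps,
        rule wp_call[OF spec_full], simp only: False enc_bool_simps, simp add: wp_simps)
  qed
next
  case (Suc d)
  obtain W' acc' where g: "greedy ids n W acc = (W', acc')" by fastforce
  have gr: "spec f_greedy
     [enc_verts ids, enc_verts ids, enc_rows ids, enc_cols ids, eset W, enc_plan acc]
     (Node (eset W') (enc_plan acc')) (t_greedy N)"
    using spec_greedy_ids[OF Suc.prems] g by (metis case_prod_conv)
  have W': "W' \<subseteq> V" using greedy_subset[OF Suc.prems g] .
  show ?case
  proof (cases "V \<subseteq> W'")
    case True
    then have r: "solve ids (Suc d) W acc = Some acc'" using g by simp
    show ?thesis unfolding spec_def painter_nth(12) b_solve_def r
      by (simp add: wp_simps, rule wp_call[OF gr], simp add: wp_simps,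
        rule wp_call[OF spec_full], simp only: True enc_bool_simps, simp add: wp_simps)
  next
    case False
    have "(length ids + 1) * (t_solve N d + t_stroke N + 4 * t_row N + 200)
        \<le> (N + 1) * (t_solve N d + t_stroke N + 4 * t_row N + 200)"
      using n_le by (intro mult_le_mono) auto
    then have se: "spec f_search
     [enc_verts ids, enc_nat d, enc_verts ids, enc_rows ids, enc_cols ids, eset W', enc_plan acc']
     (enc_result (solve ids (Suc d) W acc))
     ((N + 1) * (t_solve N d + t_stroke N + 4 * t_row N + 200))"
      by (intro spec_cong[OF spec_search[OF Suc.IH W']]) (use g False in simp_all)
    show ?thesis unfolding spec_def painter_nth(12) b_solve_def
      by (simp add: wp_simps del: solve.simps, rule wp_call[OF gr],
        simp add: wp_simps del: solve.simps,
        rule wp_call[OF spec_full], simp only: False enc_bool_simps,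
        simp add: wp_simps del: solve.simps, rule wp_call[OF se], simp del: solve.simps)
  qed
qed

lemma spec_deepen_aux:
  assumes "W \<subseteq> V" "\<forall>d \<in> set ds. d \<le> 4"
  shows "spec f_deepen [enc_list (map enc_nat ds), enc_verts ids, enc_rows ids, enc_cols ids,
       eset W, enc_plan acc]
     (enc_result (first_some (\<lambda>d. solve ids d W acc) ds))
     ((length ds + 1) * (t_solve N 4 + 50))"
  using assms(2)
proof (induction ds)
  case Nil
  show ?case unfolding spec_def painter_nth b_deepen_def by (simp add: wp_simps)
next
  case (Cons d ds)
  let ?f = "\<lambda>d. solve ids d W acc"
  have IH: "spec f_deepen [enc_list (map enc_nat ds), enc_verts ids, enc_rows ids, enc_cols ids,
       eset W, enc_plan acc] (enc_result (first_some ?f ds)) ((length ds + 1) * (t_solve N 4 + 50))"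
    and sol: "spec f_solve
      [enc_nat d, enc_verts ids, enc_rows ids, enc_cols ids, eset W, enc_plan acc]
      (enc_result (?f d)) (t_solve N 4)"
    using Cons spec_mono[OF spec_solve[OF assms(1)] t_solve_mono] by auto
  show ?case
  proof (cases "?f d")
    case None
    then have r: "first_some ?f (d # ds) = first_some ?f ds" by simp
    show ?thesis unfolding spec_def painter_nth(14) b_deepen_def r
      by (simp add: wp_simps, rule wp_call[OF sol], simp add: None wp_simps,
        rule wp_call[OF IH], simp)
  next
    case (Some ss)
    then have r: "first_some ?f (d # ds) = Some ss" by simp
    show ?thesis unfolding spec_def painter_nth(14) b_deepen_def r
      by (simp add: wp_simps, rule wp_call[OF sol], simp add: Some wp_simps)
  qed
qed

lemma spec_deepen:
  assumes "W \<subseteq> V"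
  shows "spec f_deepen [enc_list (map enc_nat [0..<5]), enc_verts ids, enc_rows ids, enc_cols ids,
       eset W, enc_plan acc]
     (enc_result (deepen ids W acc)) (t_deepen N)"
  by (rule spec_cong[OF spec_deepen_aux[OF assms]]) (auto simp: deepen_def t_deepen_def)

lemma qcost_depths: "qcost (enc_list (map enc_nat [0..<5])) \<le> 50"
  by (simp add: upt_rec eval_nat_numeral)

lemma spec_loop:
  assumes "set us \<subseteq> V"
  shows "spec f_loop
     [enc_verts us, enc_verts ids, enc_rows ids, enc_cols ids, eset Done, enc_plan acc]
     (enc_plan (solve_all ids us Done acc))
     ((length us + 1) * (t_iter N + t_deepen N + 5 * t_row N + 300))"
  using assms
proof (induction us arbitrary: Done acc)
  case Nil
  show ?case unfolding spec_def painter_nth b_loop_def by (simp add: wp_simps)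
next
  case (Cons u us)
  let ?K = "component V u"
  have u: "u \<in> V" and IH: "\<And>Done acc. spec f_loop
     [enc_verts us, enc_verts ids, enc_rows ids, enc_cols ids, eset Done, enc_plan acc]
     (enc_plan (solve_all ids us Done acc))
     ((length us + 1) * (t_iter N + t_deepen N + 5 * t_row N + 300))"
    using Cons by auto
  note mem = spec_mem[OF u, of Done]
  show ?case
  proof (cases "u \<in> Done")
    case True
    then have r: "solve_all ids (u # us) Done acc = solve_all ids us Done acc" by simp
    show ?thesis unfolding spec_def painter_nth(21) b_loop_def r
      by (simp add: wp_simps, rule wp_call[OF mem], simp add: True wp_simps,
        rule wp_call[OF IH], simp)
  next
    case False
    have full: "spec f_not [eset {}] (eset V) (t_row N)"
      using spec_complement[of "{}"] by simp
    have dp: "spec f_deepen [enc_list (map enc_nat [0..<5]), enc_verts ids, enc_rows ids,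
       enc_cols ids, eset (V - ?K), enc_plan acc]
       (enc_result (deepen ids (V - ?K) acc)) (t_deepen N)"
      by (rule spec_deepen) auto
    \<comment> \<open>A name for the constant keeps it opaque during symbolic execution; only its
      \<open>qcost\<close> is needed.\<close>
    define depths where "depths = enc_list (map enc_nat [0..<5])"
    note dp = dp[folded depths_def]
    have qc: "qcost depths \<le> 50" using qcost_depths by (simp only: depths_def)
    show ?thesis
    proof (cases "deepen ids (V - ?K) acc")
      case None
      then have r: "solve_all ids (u # us) Done acc = []" using False by simp
      show ?thesis unfolding spec_def painter_nth(21) b_loop_def r depths_def[symmetric]
        by (simp add: wp_simps wp_quote, rule wp_call[OF mem], simp add: False wp_simps wp_quote,
          rule wp_call[OF spec_empty], (simp add: wp_simps wp_quote)?, rule wp_call[OF full],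
          rule wp_call[OF spec_component[OF u u]], (simp add: wp_simps wp_quote)?,
          rule wp_call[OF spec_complement],
          rule wp_call[OF dp], simp add: None wp_simps, use qc in simp)
    next
      case (Some ss)
      then have r: "solve_all ids (u # us) Done acc = solve_all ids us (Done \<union> ?K) ss"
        using False by simp
      show ?thesis unfolding spec_def painter_nth(21) b_loop_def r depths_def[symmetric]
        by (simp add: wp_simps wp_quote, rule wp_call[OF mem], simp add: False wp_simps wp_quote,
          rule wp_call[OF spec_empty], (simp add: wp_simps wp_quote)?, rule wp_call[OF full],
          rule wp_call[OF spec_component[OF u u]], (simp add: wp_simps wp_quote)?,
          rule wp_call[OF spec_complement],
          rule wp_call[OF dp], simp add: Some wp_simps, rule wp_call[OF spec_union],
          rule wp_call[OF IH], use qc in simp)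
    qed
  qed
qed

lemma spec_main:
  "spec f_main [enc_rows ids, K, enc_cols ids] (enc_plan (solve_all ids ids {} [])) (t_main N)"
proof -
  have "(length (map t ids) + 1) * (100 * (length (map t ids) + 1) + 50) \<le> t_verts N"
    unfolding t_verts_def using n_le by (intro mult_le_mono) auto
  moreover have "map (\<lambda>i. Node (enc_nat (map t ids ! i)) (enc_on [0..<length (map t ids)] {i}))
      [0..<length (map t ids)] = map (\<lambda>u. Node (enc_nat (t u)) (eset {u})) ids"
    by (simp add: ids_def)
  ultimately have vs: "spec f_verts [enc_cols ids] (enc_verts ids) (t_verts N)"
    using spec_cong[OF spec_verts[of "map t ids"]]
    by (simp add: enc_cols_def enc_verts_def comp_def)
  have "(length ids + 1) * (t_iter N + t_deepen N + 5 * t_row N + 300) \<le> t_loop N"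
    unfolding t_loop_def using n_le by (intro mult_le_mono) auto
  then have lp: "spec f_loop
     [enc_verts ids, enc_verts ids, enc_rows ids, enc_cols ids, eset {}, Leaf]
     (enc_plan (solve_all ids ids {} [])) (t_loop N)"
    using spec_mono[OF spec_loop[of ids "{}" "[]"]] by simp
  show ?thesis unfolding spec_def painter_nth b_main_def
    by (simp add: wp_simps, rule wp_call[OF vs], (simp add: wp_simps)?,
      rule wp_call[OF spec_empty], (simp add: wp_simps)?, rule wp_call[OF lp],
      simp add: t_main_def)
qed

end

section \<open>Polynomial bounds and conclusion\<close>

definition poly_bounded :: "(nat \<Rightarrow> nat) \<Rightarrow> bool" where
  "poly_bounded f \<longleftrightarrow> (\<exists>a d. \<forall>N \<ge> 1. f N \<le> a * N ^ d)"

lemma poly_bounded_const: "poly_bounded (\<lambda>N. c)"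
  unfolding poly_bounded_def by (intro exI[of _ c] exI[of _ 0]) simp

lemma poly_bounded_id: "poly_bounded (\<lambda>N. N)"
  unfolding poly_bounded_def by (intro exI[of _ 1]) simp

text \<open>Merging exponents uses \<open>N ^ d \<le> N ^ (d + e)\<close>, which can fail at
  \<open>N = 0\<close>; hence the restriction to positive \<open>N\<close> in
  \<open>poly_bounded\<close>.\<close>

lemma poly_bounded_add:
  assumes "poly_bounded f" "poly_bounded g"
  shows "poly_bounded (\<lambda>N. f N + g N)"
proof -
  obtain a d b e where f: "\<And>N. N \<ge> 1 \<Longrightarrow> f N \<le> a * N ^ d" and g: "\<And>N. N \<ge> 1 \<Longrightarrow> g N \<le> b * N ^ e"
    using assms unfolding poly_bounded_def by blast
  have "f N + g N \<le> (a + b) * N ^ (d + e)" if "N \<ge> 1" for N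
  proof -
    have "a * N ^ d \<le> a * N ^ (d + e)" "b * N ^ e \<le> b * N ^ (d + e)"
      using that by (intro mult_le_mono power_increasing; simp)+
    then show ?thesis
      unfolding distrib_right using f[OF that] g[OF that] by (meson add_mono order_trans)
  qed
  then show ?thesis unfolding poly_bounded_def by blast
qed

lemma poly_bounded_mult:
  assumes "poly_bounded f" "poly_bounded g"
  shows "poly_bounded (\<lambda>N. f N * g N)"
proof -
  obtain a d b e where f: "\<And>N. N \<ge> 1 \<Longrightarrow> f N \<le> a * N ^ d" and g: "\<And>N. N \<ge> 1 \<Longrightarrow> g N \<le> b * N ^ e"
    using assms unfolding poly_bounded_def by blast
  have "f N * g N \<le> (a * b) * N ^ (d + e)" if "N \<ge> 1" for N
    using mult_le_mono[OF f[OF that] g[OF that]] by (simp add: power_add algebra_simps)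
  then show ?thesis unfolding poly_bounded_def by blast
qed

lemmas poly_bounded_intros =
  poly_bounded_const poly_bounded_id poly_bounded_add poly_bounded_mult

lemma poly_bounded_t_solve: "poly_bounded (\<lambda>N. t_solve N d)"
proof (induction d)
  case 0
  show ?case
    unfolding t_solve.simps t_greedy_def t_find_def t_stroke_def t_iter_def t_step_def t_row_def
    by (intro poly_bounded_intros)
next
  case (Suc d)
  show ?case
    unfolding t_solve.simps t_greedy_def t_find_def t_stroke_def t_iter_def t_step_def t_row_def
    by (intro poly_bounded_intros Suc)
qed

lemma poly_bounded_t_main: "poly_bounded t_main"
proof -
  have "poly_bounded (\<lambda>N. t_main N)"
    unfolding t_main_def t_verts_def t_loop_def t_deepen_def t_iter_def t_step_def t_row_def
    by (intro poly_bounded_intros poly_bounded_t_solve)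
  then show ?thesis by simp
qed

theorem theorem14:
  shows "\<exists>(P :: program) (a :: nat) (d :: nat).
    \<forall>(n :: nat) (k :: nat) (G :: nat pair_pre_digraph) (t :: nat \<Rightarrow> nat).
      n \<ge> 1 \<longrightarrow> pair_graph G \<longrightarrow> pverts G = {..<n} \<longrightarrow> co_gem_free G \<longrightarrow>
      t \<in> pverts G \<rightarrow> {..<k} \<longrightarrow>
      (\<exists>ss s. optimal_paint_plan G {..<k} t ss \<and>
        computes P [enc_graph n G, enc_nat k, enc_template n t] (enc_plan ss) s \<and>
        s \<le> a * (n + k) ^ d)"
proof -
  obtain a d where ad: "\<And>N. N \<ge> 1 \<Longrightarrow> t_main N \<le> a * N ^ d"
    using poly_bounded_t_main unfolding poly_bounded_def by blast
  have "\<exists>ss s. optimal_paint_plan G {..<k} t ss \<and>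
      computes painter [enc_graph n G, enc_nat k, enc_template n t] (enc_plan ss) s \<and>
      s \<le> a * (n + k) ^ d"
    if n: "n \<ge> 1" and G: "pair_graph G" "pverts G = {..<n}" "co_gem_free G"
      and t: "t \<in> pverts G \<rightarrow> {..<k}" for n k and G :: "nat pair_pre_digraph" and t :: "nat \<Rightarrow> nat"
  proof -
    interpret coloured_graph "pverts G" "parcs G" t
      by (rule coloured_graph_of_pair_graph) fact
    \<comment> \<open>The sum \<open>n + k\<close> exceeds every colour and is at least the number
      of vertices.\<close>
    interpret encoded_graph "pverts G" "parcs G" t n "n + k"
      by unfold_locales (use G funcset_mem[OF t] in \<open>fastforce+\<close>)
    define ss where "ss = solve_all ids ids {} []"
    have "optimal_on (pverts G) (rev ss)"
      unfolding ss_def by (rule solve_all_optimal[OF no_co_gem_if_co_gem_free[OF G(1,3)] set_ids])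
    moreover have "pverts G \<noteq> {}" using G(2) n by (metis lessThan_empty_iff not_one_le_zero bot_nat_def)
    ultimately have opt: "optimal_paint_plan G {..<k} t ss"
      by (intro optimal_paint_plan_rev[OF G(1) t])
    \<comment> \<open>Row \<open>u\<close> of the adjacency matrix is the bit list of the
      neighbourhood of \<open>u\<close>.\<close>
    have graph: "enc_graph n G = enc_rows ids" and template: "enc_template n t = enc_cols ids"
      by (simp_all add: enc_graph_def enc_rows_def enc_on_def enc_template_def enc_cols_def ids_def)
    obtain s where s: "eval painter [enc_graph n G, enc_nat k, enc_template n t] (painter ! f_main)
        (enc_plan ss) s" "s \<le> t_main (n + k)"
      using spec_main[of "enc_nat k"] unfolding spec_def wp_def graph template ss_def by blast
    then have "computes painter [enc_graph n G, enc_nat k, enc_template n t] (enc_plan ss) s"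
      unfolding computes_def by (simp add: f_main_def painter_def)
    moreover have "s \<le> a * (n + k) ^ d" using s(2) ad[of "n + k"] n by simp
    ultimately show ?thesis using opt by blast
  qed
  then show ?thesis by blast
qed

end
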